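(* For every $u>0$ there is a constant $C=C(u)>0$ such that for every Dirichlet series $D=\sum a_n n^{-s}\in\mathcal{H}_2$ we have $$\Big(\int_{\Xi}\sup_{x\in\mathbb{N}}\Big|\sum_{n=1}^{x}\frac{a_n}{n^u}\chi(n)\Big|^2 d\chi\Big)^{1/2}\le C\,\|D\|_2 .$$ Equivalently, for every $f\in H_2(\mathbb{T}^\infty)$, $$\Big(\int_{\mathbb{T}^\infty}\sup_{x>0}\Big|\sum_{\mathfrak{p}^\alpha<x}\frac{\widehat f(\alpha)}{\mathfrak{p}^{u\alpha}}z^\alpha\Big|^2dz\Big)^{1/2}\le C\,\|f\|_2 .$$
   Context: $\mathbb{T}=\{w\in\mathbb{C}:|w|=1\}$; $\mathbb{T}^\infty$ is the countable product of copies of $\mathbb{T}$, a compact abelian group with normalized Haar measure $dz$. $\mathfrak{p}=(p_k)_{k\ge1}=(2,3,5,\dots)$ is the sequence of primes. For a finitely supported integer sequence $\alpha\in\mathbb{Z}^{(\mathbb{N})}$ put $z^\alpha=\prod_k z_k^{\alpha_k}$, $\mathfrak{p}^\alpha=\prod_k p_k^{\alpha_k}$ and $\mathfrak{p}^{u\alpha}=(\mathfrak{p}^\alpha)^u$; $\widehat f(\alpha)=\int_{\mathbb{T}^\infty}f(z)\overline{z^\alpha}\,dz$. $H_p(\mathbb{T}^\infty)$, $1\le p\le\infty$, is the closed subspace of those $f\in L_p(\mathbb{T}^\infty)$ with $\widehat f(\alpha)=0$ for $\alpha\notin\mathbb{N}_0^{(\mathbb{N})}$ (finitely supported sequences of nonnegative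 integers); sums over $\mathfrak{p}^\alpha<x$ run over $\alpha\in\mathbb{N}_0^{(\mathbb{N})}$. $\mathcal{H}_p$ is the space of all (formal) Dirichlet series $D=\sum a_n n^{-s}$ for which there is a (unique) $f\in H_p(\mathbb{T}^\infty)$ with $a_n=\widehat f(\alpha)$ whenever $n=\mathfrak{p}^\alpha$, $\alpha\in\mathbb{N}_0^{(\mathbb{N})}$; its norm is $\|D\|_p=\|f\|_p$. (In particular $D\in\mathcal{H}_2$ iff $(a_n)\in\ell_2$, with $\|D\|_2=\|(a_n)\|_{\ell_2}$.) $\Xi$ is the set of all completely multiplicative functions $\chi:\mathbb{N}\to\mathbb{T}$, identified with $\mathbb{T}^\infty$ via the group isomorphism $\chi\mapsto(\chi(p_k))_k$; $d\chi$ is the Haar measure corresponding to $dz$ under this identification. *)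

theory Defs
  imports
    "HOL-Probability.Probability"
    "HOL-Library.Poly_Mapping"
    "HOL-Computational_Algebra.Primes"
begin

section \<open>Haar measure on the infinite polytorus\<close>

abbreviation torus :: "complex set" where
  "torus \<equiv> sphere 0 1"

text \<open>Normalized Haar measure on the circle group, as the image of Lebesgue measure on
  \<open>[0,1]\<close> under \<open>t \<mapsto> exp (2 \<pi> i t)\<close>.\<close>

definition circle_haar :: "complex measure" where
  "circle_haar =
     distr (uniform_measure lborel {0..1}) (restrict_space borel torus) (\<lambda>t. cis (2 * pi * t))"

text \<open>The countable product carries the product measure; its \<open>\<sigma>\<close>-algebra is the Borel
  \<open>\<sigma>\<close>-algebra of the (second countable) product topology. The lemmas
  \<open>prob_space_haar_Tinf\<close> and \<open>haar_Tinf_invariant\<close> below show that this is the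
  normalized Haar measure. Coordinates are numbered from \<open>0\<close>.\<close>

definition haar_Tinf :: "(nat \<Rightarrow> complex) measure" where
  "haar_Tinf = PiM UNIV (\<lambda>_. circle_haar)"

lemma circle_haar_measurable:
  "(\<lambda>t. cis (2 * pi * t)) \<in> uniform_measure lborel {0..1} \<rightarrow>\<^sub>M restrict_space borel torus"
proof (rule measurable_restrict_space2)
  show "(\<lambda>t. cis (2 * pi * t)) \<in> borel_measurable (uniform_measure lborel {0..1})"
    by (subst measurable_cong_sets[where M' = lborel and N' = borel])
       (auto intro!: borel_measurable_continuous_onI continuous_intros)
qed auto

lemma sets_circle_haar: "sets circle_haar = sets (restrict_space borel torus)"
  by (simp add: circle_haar_def)

lemma space_circle_haar: "space circle_haar = torus"
  by (simp add: circle_haar_def space_restrict_space)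

lemma space_haar_Tinf: "space haar_Tinf = {z. \<forall>k. z k \<in> torus}"
  by (auto simp: haar_Tinf_def space_PiM space_circle_haar PiE_def Pi_def)

lemma prob_space_circle_haar: "prob_space circle_haar"
  unfolding circle_haar_def
  by (intro prob_space.prob_space_distr prob_space_uniform_measure circle_haar_measurable) auto

lemma prob_space_haar_Tinf: "prob_space haar_Tinf"
  unfolding haar_Tinf_def by (intro prob_space_PiM prob_space_circle_haar)

lemma measurable_circle_indicator:
  assumes "A \<in> sets circle_haar"
  shows "(\<lambda>t. indicator A (cis (2 * pi * t)) :: ennreal)
           \<in> borel_measurable (uniform_measure lborel {0..1})"
  by (rule measurable_compose[OF circle_haar_measurable])
     (use assms in \<open>auto simp: sets_circle_haar intro!: borel_measurable_indicator\<close>)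

lemma emeasure_circle_haar:
  assumes "A \<in> sets circle_haar"
  shows "emeasure circle_haar A = (\<integral>\<^sup>+t\<in>{0..<1}. indicator A (cis (2 * pi * t)) \<partial>lborel)"
proof -
  have "emeasure circle_haar A = (\<integral>\<^sup>+x. indicator A x \<partial>circle_haar)"
    using assms by simp
  also have "\<dots> = (\<integral>\<^sup>+t. indicator A (cis (2 * pi * t)) \<partial>uniform_measure lborel {0..1})"
    unfolding circle_haar_def
    by (rule nn_integral_distr[OF circle_haar_measurable])
       (use assms in \<open>auto simp: sets_circle_haar intro!: borel_measurable_indicator\<close>)
  also have "\<dots> = (\<integral>\<^sup>+t\<in>{0..1}. indicator A (cis (2 * pi * t)) \<partial>lborel)"
  proof -
    have "(\<lambda>t. indicator A (cis (2 * pi * t)) :: ennreal)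
            \<in> borel_measurable (uniform_measure lborel {0..1})"
      by (rule measurable_circle_indicator[OF assms])
    then have "(\<lambda>t. indicator A (cis (2 * pi * t)) :: ennreal) \<in> borel_measurable lborel"
      by simp
    then show ?thesis
      by (subst nn_integral_uniform_measure) (auto simp: divide_ennreal_def)
  qed
  also have "\<dots> = (\<integral>\<^sup>+t\<in>{0..<1}. indicator A (cis (2 * pi * t)) \<partial>lborel)"
    by (intro nn_integral_cong_AE) (use AE_lborel_singleton[of 1] in eventually_elim,
        auto simp: indicator_def)
  finally show ?thesis .
qed

lemma nn_integral_period_shift:
  fixes g :: "real \<Rightarrow> ennreal"
  assumes [measurable]: "g \<in> borel_measurable borel" and per: "\<And>t. g (t + 1) = g t"
    and s: "0 \<le> s" "s < 1"
  shows "(\<integral>\<^sup>+t\<in>{0..<1}. g (s + t) \<partial>lborel) = (\<integral>\<^sup>+t\<in>{0..<1}. g t \<partial>lborel)"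
proof -
  have "(\<integral>\<^sup>+t\<in>{0..<1}. g (s + t) \<partial>lborel) = (\<integral>\<^sup>+t. g (s + t) * indicator {s..<s+1} (s + t) \<partial>lborel)"
    by (intro nn_integral_cong) (auto simp: indicator_def)
  also have "\<dots> = (\<integral>\<^sup>+t. g t * indicator {s..<s+1} t \<partial>lborel)"
    using nn_integral_real_affine[of "\<lambda>t. g t * indicator {s..<s+1} t" 1 s] by simp
  also have "\<dots> = (\<integral>\<^sup>+t. g t * indicator {s..<1} t + g t * indicator {1..<s+1} t \<partial>lborel)"
    using s by (intro nn_integral_cong) (auto simp: indicator_def)
  also have "\<dots> = (\<integral>\<^sup>+t. g t * indicator {s..<1} t \<partial>lborel) + (\<integral>\<^sup>+t. g t * indicator {1..<s+1} t \<partial>lborel)"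
    by (rule nn_integral_add) auto
  also have "(\<integral>\<^sup>+t. g t * indicator {1..<s+1} t \<partial>lborel)
      = (\<integral>\<^sup>+t. g (1 + t) * indicator {1..<s+1} (1 + t) \<partial>lborel)"
    using nn_integral_real_affine[of "\<lambda>t. g t * indicator {1..<s+1} t" 1 1] by simp
  also have "\<dots> = (\<integral>\<^sup>+t. g t * indicator {0..<s} t \<partial>lborel)"
    using per by (intro nn_integral_cong) (auto simp: indicator_def add.commute)
  also have "(\<integral>\<^sup>+t. g t * indicator {s..<1} t \<partial>lborel) + (\<integral>\<^sup>+t. g t * indicator {0..<s} t \<partial>lborel)
      = (\<integral>\<^sup>+t. g t * indicator {s..<1} t + g t * indicator {0..<s} t \<partial>lborel)"
    by (rule nn_integral_add[symmetric]) auto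
  also have "\<dots> = (\<integral>\<^sup>+t\<in>{0..<1}. g t \<partial>lborel)"
    using s by (intro nn_integral_cong) (auto simp: indicator_def)
  finally show ?thesis .
qed

lemma rotation_measurable:
  assumes "c \<in> torus"
  shows "(\<lambda>x. c * x) \<in> circle_haar \<rightarrow>\<^sub>M circle_haar"
proof -
  have "(\<lambda>x. c * x) \<in> restrict_space borel torus \<rightarrow>\<^sub>M restrict_space borel torus"
    using assms
    by (intro measurable_restrict_space3 borel_measurable_continuous_onI continuous_intros)
       (auto simp: norm_mult)
  then show ?thesis
    by (subst measurable_cong_sets[OF sets_circle_haar sets_circle_haar])
qed

lemma circle_haar_invariant:
  assumes c: "c \<in> torus"
  shows "distr circle_haar circle_haar (\<lambda>x. c * x) = circle_haar"
proof (rule measure_eqI)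
  fix A assume "A \<in> sets (distr circle_haar circle_haar (\<lambda>x. c * x))"
  then have A: "A \<in> sets circle_haar" by simp
  define r where "r = Arg2pi c / (2 * pi)"
  have r: "0 \<le> r" "r < 1"
    using Arg2pi_ge_0[of c] Arg2pi_lt_2pi[of c] by (auto simp: r_def field_simps)
  have cr: "c = cis (2 * pi * r)"
    using Arg2pi_eq[of c] c by (simp add: r_def cis_conv_exp mult.commute)
  define g :: "real \<Rightarrow> ennreal" where "g t = indicator A (cis (2 * pi * t))" for t
  have "(\<lambda>t. indicator A (cis (2 * pi * t)) :: ennreal)
            \<in> borel_measurable (uniform_measure lborel {0..1})"
    by (rule measurable_circle_indicator[OF A])
  then have g: "g \<in> borel_measurable borel" by (simp add: g_def[abs_def])
  have per: "g (t + 1) = g t" for t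
    by (simp add: g_def distrib_left flip: cis_mult)
  let ?B = "(\<lambda>x. c * x) -` A \<inter> space circle_haar"
  have B: "?B \<in> sets circle_haar"
    by (rule measurable_sets[OF rotation_measurable[OF c] A])
  have "emeasure (distr circle_haar circle_haar (\<lambda>x. c * x)) A = emeasure circle_haar ?B"
    by (rule emeasure_distr[OF rotation_measurable[OF c] A])
  also have "\<dots> = (\<integral>\<^sup>+t\<in>{0..<1}. indicator ?B (cis (2 * pi * t)) \<partial>lborel)"
    by (rule emeasure_circle_haar[OF B])
  also have "\<dots> = (\<integral>\<^sup>+t\<in>{0..<1}. g (r + t) \<partial>lborel)"
    by (intro nn_integral_cong)
       (auto simp: g_def indicator_def cr cis_mult distrib_left space_circle_haar)
  also have "\<dots> = (\<integral>\<^sup>+t\<in>{0..<1}. g t \<partial>lborel)"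
    by (rule nn_integral_period_shift[OF g per r])
  also have "\<dots> = emeasure circle_haar A"
    by (simp add: g_def emeasure_circle_haar[OF A])
  finally show "emeasure (distr circle_haar circle_haar (\<lambda>x. c * x)) A = emeasure circle_haar A" .
qed simp

lemma haar_Tinf_invariant:
  assumes w: "w \<in> space haar_Tinf"
  shows "distr haar_Tinf haar_Tinf (\<lambda>z k. w k * z k) = haar_Tinf"
proof -
  have wk: "w k \<in> torus" for k using w by (simp add: space_haar_Tinf)
  interpret product_prob_space "\<lambda>_::nat. circle_haar" UNIV
    by (simp add: product_prob_space_def product_prob_space_axioms_def product_sigma_finite_def
        prob_space_circle_haar prob_space_imp_sigma_finite)
  have rot: "(\<lambda>z k. w k * z k) \<in> haar_Tinf \<rightarrow>\<^sub>M haar_Tinf"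
    unfolding haar_Tinf_def
  proof (rule measurable_PiM_single')
    show "(\<lambda>z. w k * z k) \<in> PiM UNIV (\<lambda>_. circle_haar) \<rightarrow>\<^sub>M circle_haar" for k :: nat
      using rotation_measurable[OF wk[of k]]
      by (rule measurable_compose[rotated]) (rule measurable_component_singleton, simp)
    show "(\<lambda>z k. w k * z k)
            \<in> space (PiM UNIV (\<lambda>_. circle_haar)) \<rightarrow> (UNIV \<rightarrow>\<^sub>E space circle_haar)"
      using wk by (auto simp: space_PiM space_circle_haar PiE_iff norm_mult)
  qed
  show ?thesis
    unfolding haar_Tinf_def
  proof (rule PiM_eq)
    fix J :: "nat set" and X assume J: "finite J" "J \<subseteq> UNIV"
      and X: "\<And>j. j \<in> J \<Longrightarrow> X j \<in> sets circle_haar"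
    let ?Y = "\<lambda>j. (\<lambda>x. w j * x) -` X j \<inter> space circle_haar"
    have Y: "?Y j \<in> sets circle_haar" if "j \<in> J" for j
      by (rule measurable_sets[OF rotation_measurable[OF wk] X[OF that]])
    let ?E = "prod_emb UNIV (\<lambda>_. circle_haar) J"
    have E: "?E (Pi\<^sub>E J X) \<in> sets (PiM UNIV (\<lambda>_. circle_haar))"
      by (rule sets_PiM_I[OF J]) (use X in auto)
    have "(\<lambda>z k. w k * z k) -` ?E (Pi\<^sub>E J X) \<inter> space haar_Tinf = ?E (Pi\<^sub>E J ?Y)"
      using wk by (auto simp: prod_emb_def space_haar_Tinf space_circle_haar PiE_iff norm_mult
          extensional_def)
    then have "emeasure (distr (PiM UNIV (\<lambda>_. circle_haar)) (PiM UNIV (\<lambda>_. circle_haar))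
                  (\<lambda>z k. w k * z k)) (?E (Pi\<^sub>E J X))
        = emeasure (PiM UNIV (\<lambda>_. circle_haar)) (?E (Pi\<^sub>E J ?Y))"
      using emeasure_distr[OF rot[unfolded haar_Tinf_def] E] by (simp add: haar_Tinf_def)
    also have "\<dots> = (\<Prod>j\<in>J. emeasure circle_haar (?Y j))"
      by (rule emeasure_PiM_emb) (use J Y in auto)
    also have "\<dots> = (\<Prod>j\<in>J. emeasure circle_haar (X j))"
    proof (rule prod.cong[OF refl])
      fix j assume "j \<in> J"
      show "emeasure circle_haar (?Y j) = emeasure circle_haar (X j)"
        using emeasure_distr[OF rotation_measurable[OF wk[of j]] X[OF \<open>j \<in> J\<close>]]
        by (simp add: circle_haar_invariant[OF wk])
    qed
    finally show "emeasure (distr (PiM UNIV (\<lambda>_. circle_haar)) (PiM UNIV (\<lambda>_. circle_haar))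
                  (\<lambda>z k. w k * z k)) (?E (Pi\<^sub>E J X)) = (\<Prod>j\<in>J. emeasure circle_haar (X j))" .
  qed simp
qed


section \<open>Fourier coefficients and Hardy spaces\<close>

text \<open>Finitely supported integer sequences are elements of \<^typ>\<open>nat \<Rightarrow>\<^sub>0 int\<close>.\<close>

definition zpow :: "(nat \<Rightarrow> complex) \<Rightarrow> (nat \<Rightarrow>\<^sub>0 int) \<Rightarrow> complex" where
  "zpow z \<alpha> = (\<Prod>k\<in>Poly_Mapping.keys \<alpha>. z k powi Poly_Mapping.lookup \<alpha> k)"

definition prime_seq :: "nat \<Rightarrow> nat" where
  "prime_seq k = enumerate {p. prime p} k"

definition ppow :: "(nat \<Rightarrow>\<^sub>0 int) \<Rightarrow> real" where
  "ppow \<alpha> = (\<Prod>k\<in>Poly_Mapping.keys \<alpha>. real (prime_seq k) powi Poly_Mapping.lookup \<alpha> k)"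

definition nonneg_idx :: "(nat \<Rightarrow>\<^sub>0 int) set" where
  "nonneg_idx = {\<alpha>. \<forall>k. Poly_Mapping.lookup \<alpha> k \<ge> 0}"

definition fourier_coeff :: "((nat \<Rightarrow> complex) \<Rightarrow> complex) \<Rightarrow> (nat \<Rightarrow>\<^sub>0 int) \<Rightarrow> complex" where
  "fourier_coeff f \<alpha> = (LINT z|haar_Tinf. f z * cnj (zpow z \<alpha>))"

text \<open>Elements of \<open>L\<^sub>p\<close> and \<open>H\<^sub>p\<close> are given by representatives; only finite \<open>p\<close> is covered.\<close>

definition Lp_Tinf :: "real \<Rightarrow> ((nat \<Rightarrow> complex) \<Rightarrow> complex) set" where
  "Lp_Tinf p = {f \<in> borel_measurable haar_Tinf. integrable haar_Tinf (\<lambda>z. norm (f z) powr p)}"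

definition Lp_norm :: "real \<Rightarrow> ((nat \<Rightarrow> complex) \<Rightarrow> complex) \<Rightarrow> real" where
  "Lp_norm p f = (LINT z|haar_Tinf. norm (f z) powr p) powr (1 / p)"

definition Hp_Tinf :: "real \<Rightarrow> ((nat \<Rightarrow> complex) \<Rightarrow> complex) set" where
  "Hp_Tinf p = {f \<in> Lp_Tinf p. \<forall>\<alpha>. \<alpha> \<notin> nonneg_idx \<longrightarrow> fourier_coeff f \<alpha> = 0}"


section \<open>Hardy spaces of Dirichlet series\<close>

text \<open>The formal Dirichlet series with coefficients \<open>a\<^sub>n\<close>, \<open>n \<ge> 1\<close>, is represented by the
  sequence \<open>a\<close>; the value \<open>a 0\<close> is irrelevant.\<close>

definition is_bohr_lift ::
    "real \<Rightarrow> (nat \<Rightarrow> complex) \<Rightarrow> ((nat \<Rightarrow> complex) \<Rightarrow> complex) \<Rightarrow> bool" where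
  "is_bohr_lift p a f \<longleftrightarrow> f \<in> Hp_Tinf p \<and>
     (\<forall>n \<alpha>. \<alpha> \<in> nonneg_idx \<and> real n = ppow \<alpha> \<longrightarrow> a n = fourier_coeff f \<alpha>)"

definition dirichlet_Hp :: "real \<Rightarrow> (nat \<Rightarrow> complex) set" where
  "dirichlet_Hp p = {a. \<exists>f. is_bohr_lift p a f}"

text \<open>The lift is unique almost everywhere, so the norm does not depend on its choice.\<close>

definition dirichlet_norm :: "real \<Rightarrow> (nat \<Rightarrow> complex) \<Rightarrow> real" where
  "dirichlet_norm p a = Lp_norm p (SOME f. is_bohr_lift p a f)"


section \<open>Completely multiplicative characters\<close>

text \<open>Functions on \<open>{1,2,...}\<close>, extended by \<open>undefined\<close> at \<open>0\<close>.\<close>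

definition Xi :: "(nat \<Rightarrow> complex) set" where
  "Xi = {\<xi>. \<xi> \<in> {1..} \<rightarrow>\<^sub>E torus \<and> (\<forall>m\<ge>1. \<forall>n\<ge>1. \<xi> (m * n) = \<xi> m * \<xi> n)}"

definition Xi_iso :: "(nat \<Rightarrow> complex) \<Rightarrow> (nat \<Rightarrow> complex)" where
  "Xi_iso \<xi> = (\<lambda>k. \<xi> (prime_seq k))"

definition haar_Xi :: "(nat \<Rightarrow> complex) measure" where
  "haar_Xi = distr haar_Tinf (vimage_algebra Xi Xi_iso haar_Tinf) (the_inv_into Xi Xi_iso)"

lemma bij_prime_seq: "bij_betw prime_seq UNIV {p. prime p}"
  unfolding prime_seq_def by (rule bij_enumerate[OF primes_infinite])

lemma Xi_mult: "\<xi> \<in> Xi \<Longrightarrow> m \<ge> 1 \<Longrightarrow> n \<ge> 1 \<Longrightarrow> \<xi> (m * n) = \<xi> m * \<xi> n"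
  by (simp add: Xi_def)

lemma Xi_norm: "\<xi> \<in> Xi \<Longrightarrow> n \<ge> 1 \<Longrightarrow> norm (\<xi> n) = 1"
  by (auto simp: Xi_def PiE_iff)

lemma Xi_one: "\<xi> \<in> Xi \<Longrightarrow> \<xi> 1 = 1"
proof -
  assume "\<xi> \<in> Xi"
  then have "\<xi> 1 = \<xi> 1 * \<xi> 1" "\<xi> 1 \<noteq> 0"
    using Xi_mult[of \<xi> 1 1] Xi_norm[of \<xi> 1] by (simp, force)
  then show ?thesis by (metis mult_cancel_left1)
qed

lemma bij_Xi_iso: "bij_betw Xi_iso Xi (space haar_Tinf)"
proof (rule bij_betwI')
  fix \<xi> \<psi> assume \<xi>: "\<xi> \<in> Xi" and \<psi>: "\<psi> \<in> Xi"
  show "(Xi_iso \<xi> = Xi_iso \<psi>) = (\<xi> = \<psi>)"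
  proof
    assume eq: "Xi_iso \<xi> = Xi_iso \<psi>"
    have pr: "\<xi> p = \<psi> p" if "prime p" for p
    proof -
      have "p \<in> range prime_seq"
        using bij_betw_imp_surj_on[OF bij_prime_seq] that by simp
      then obtain k where "p = prime_seq k" ..
      then show ?thesis using fun_cong[OF eq, of k] by (simp add: Xi_iso_def)
    qed
    have *: "n \<ge> 1 \<Longrightarrow> \<xi> n = \<psi> n" for n
    proof (induction n rule: prime_divisors_induct)
      case zero then show ?case by simp
    next
      case (unit n) then show ?case using Xi_one[OF \<xi>] Xi_one[OF \<psi>] by simp
    next
      case (factor p n)
      then have "n \<ge> 1" "p \<ge> 1" by (auto simp: Suc_le_eq prime_gt_0_nat)
      then show ?case using factor pr Xi_mult[OF \<xi>] Xi_mult[OF \<psi>] by simp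
    qed
    have "\<xi> 0 = undefined" "\<psi> 0 = undefined"
      using \<xi> \<psi> by (auto simp: Xi_def PiE_iff extensional_def)
    then show "\<xi> = \<psi>"
      using * by (metis ext less_one not_le)
  qed simp
next
  fix \<xi> assume \<xi>: "\<xi> \<in> Xi"
  have "prime_seq k \<ge> 1" for k
    using bij_betwE[OF bij_prime_seq] by (auto simp: Suc_le_eq prime_gt_0_nat)
  then show "Xi_iso \<xi> \<in> space haar_Tinf"
    using Xi_norm[OF \<xi>] by (auto simp: space_haar_Tinf Xi_iso_def)
next
  fix z assume z: "z \<in> space haar_Tinf"
  define w where "w p = z (the_inv prime_seq p)" for p
  define \<xi> where
    "\<xi> n = (if n = 0 then undefined else \<Prod>p\<in>#prime_factorization n. w p)" for n
  have inj: "inj prime_seq" using bij_prime_seq by (simp add: bij_betw_def)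
  have w: "norm (w p) = 1" for p using z by (simp add: w_def space_haar_Tinf)
  have nrm: "norm (\<Prod>p\<in>#M. w p) = 1" for M
    by (induction M) (auto simp: norm_mult w)
  have "\<xi> \<in> Xi"
    by (auto simp: Xi_def \<xi>_def PiE_iff extensional_def nrm prime_factorization_mult)
  moreover have "Xi_iso \<xi> = z"
  proof
    fix k
    have "prime (prime_seq k)" using bij_betwE[OF bij_prime_seq] by auto
    moreover then have "prime_seq k \<noteq> 0" by (metis not_prime_0)
    ultimately show "Xi_iso \<xi> k = z k"
      by (simp add: Xi_iso_def \<xi>_def prime_factorization_prime w_def the_inv_f_f[OF inj])
  qed
  ultimately show "\<exists>\<xi>\<in>Xi. z = Xi_iso \<xi>" by blast
qed

end

theory Submission
  imports Defs "HOL-Real_Asymp.Real_Asymp"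
begin

text \<open>The monomials \<open>z\<^sup>\<alpha>\<close> are orthonormal, so no Carleson-type theorem is needed:
  by Rademacher--Menchoff the maximal function of the block \<open>2\<^sup>j \<le> n < 2\<^sup>j\<^sup>+\<^sup>1\<close> costs only a factor
  \<open>j + 1\<close> in \<open>L\<^sub>2\<close>, while the weights \<open>n\<^sup>-\<^sup>u\<close> gain \<open>2\<^sup>-\<^sup>u\<^sup>j\<close> there. Cauchy--Schwarz with the weights
  \<open>(j + 1)\<^sup>2\<close> sums over the blocks, and Bessel's inequality bounds the coefficients.\<close>

text \<open>Sums over \<open>ppow \<alpha> < x\<close> are ordered by the size of an integer, an
  order that ignores the product structure of the polytorus. Unique factorization therefore relabels
  the monomials by n = 1, 2, ..., and the maximal estimate is proved for an arbitrary sequence of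
  functions whose consecutive sums satisfy an additive bound on squared norms. Both forms of the
  theorem then follow from \<open>maximal_inequality_Tinf\<close>. The loss that
  Rademacher--Menchoff permits is logarithmic in n, since a block of length 2^j starts at n = 2^j;
  any positive power of n absorbs it, and this is where u enters. Squared norms lose (j + 1)^2
  inside block j and another (j + 1)^2 when blocks are added, which explains the fourth power. The
  constant comes from pi^2/6 times an upper bound of (j + 1)^4 * 2^(-2uj). Suprema are handled as
  \<open>ennreal\<close> values throughout, so that finiteness of the integral is a conclusion and
  not a side condition.\<close>

section \<open>Rademacher--Menchoff inequality for 2^k summands\<close>

text \<open>A product of two values is at most the square of the larger one. Thus a pointwise bound
  on each squared partial sum suffices to bound the squared maximal function.\<close>

lemma power2_SUP_ennreal:
  fixes f :: "'i \<Rightarrow> ennreal"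
  shows "(SUP i\<in>I. f i)\<^sup>2 \<le> (SUP i\<in>I. (f i)\<^sup>2)"
proof -
  have "f i * f j \<le> (SUP i\<in>I. (f i)\<^sup>2)" if "i \<in> I" "j \<in> I" for i j
  proof (cases "f i \<le> f j")
    case True
    then have "f i * f j \<le> (f j)\<^sup>2" by (simp add: power2_eq_square mult_right_mono)
    also have "\<dots> \<le> (SUP i\<in>I. (f i)\<^sup>2)" using that by (intro SUP_upper)
    finally show ?thesis .
  next
    case False
    then have "f i * f j \<le> (f i)\<^sup>2" by (simp add: power2_eq_square mult_left_mono)
    also have "\<dots> \<le> (SUP i\<in>I. (f i)\<^sup>2)" using that by (intro SUP_upper)
    finally show ?thesis .
  qed
  moreover have "(SUP i\<in>I. f i)\<^sup>2 = (SUP j\<in>I. SUP i\<in>I. f j * f i)"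
    by (simp add: power2_eq_square SUP_mult_left_ennreal[symmetric] SUP_mult_right_ennreal[symmetric])
  ultimately show ?thesis by (auto intro!: SUP_least)
qed

text \<open>The difference of the two sides is (a - t * b)^2 / t. The free parameter t replaces
  Minkowski's inequality: it is tuned in each induction step so that the constants close up
  exactly.\<close>

lemma power2_add_weighted_le:
  fixes a b :: real
  assumes "t > 0"
  shows "(a + b)\<^sup>2 \<le> (t + 1) / t * a\<^sup>2 + (t + 1) * b\<^sup>2"
proof -
  have "(t + 1) / t * a\<^sup>2 + (t + 1) * b\<^sup>2 - (a + b)\<^sup>2 = (a - t * b)\<^sup>2 / t"
    using assms by (simp add: field_simps power2_eq_square)
  also have "\<dots> \<ge> 0" using assms by simp
  finally show ?thesis by simp
qed

lemma sum_pairs: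
  fixes g :: "nat \<Rightarrow> 'b::comm_monoid_add"
  shows "(\<Sum>i=m..<n. g (2 * i) + g (Suc (2 * i))) = sum g {2 * m..<2 * n}"
proof (cases "m \<le> n")
  case True
  then show ?thesis
    by (induction n rule: dec_induct) (auto simp: add.assoc)
qed simp

lemma sum_pairs_lessThan:
  fixes g :: "nat \<Rightarrow> 'b::comm_monoid_add"
  shows "(\<Sum>i<n. g (2 * i) + g (Suc (2 * i))) = sum g {..<2 * n}"
  using sum_pairs[where m = 0] by (simp add: atLeast0LessThan)

text \<open>The induction halves the number of summands by pairing neighbours; this changes the partial
  sums by at most one summand, and the hypothesis on consecutive sums survives the pairing.\<close>

lemma rademacher_menchoff:
  fixes g :: "nat \<Rightarrow> 'a \<Rightarrow> 'b::{real_normed_vector, second_countable_topology}"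
  assumes "\<And>i. g i \<in> borel_measurable M"
    and "\<And>m n. (\<integral>\<^sup>+z. ennreal ((norm (\<Sum>i=m..<n. g i z))\<^sup>2) \<partial>M) \<le> ennreal (\<Sum>i=m..<n. w i)"
    and "\<And>i. w i \<ge> 0"
  shows "(\<integral>\<^sup>+z. (SUP x\<in>{..2 ^ k}. ennreal ((norm (\<Sum>i<x. g i z))\<^sup>2)) \<partial>M)
           \<le> ennreal ((real k + 1)\<^sup>2 * (\<Sum>i<2 ^ k. w i))"
  using assms
proof (induction k arbitrary: g w)
  case 0
  have "(SUP x\<in>{..2 ^ 0}. ennreal ((norm (\<Sum>i<x. g i z))\<^sup>2)) \<le> ennreal ((norm (\<Sum>i=0..<1. g i z))\<^sup>2)" for z
  proof (rule SUP_least)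
    fix x :: nat assume "x \<in> {..2 ^ 0}"
    then have "x = 0 \<or> x = 1" by auto
    then show "ennreal ((norm (\<Sum>i<x. g i z))\<^sup>2) \<le> ennreal ((norm (\<Sum>i=0..<1. g i z))\<^sup>2)"
      by (auto simp: lessThan_Suc)
  qed
  then have "(\<integral>\<^sup>+z. (SUP x\<in>{..2 ^ 0}. ennreal ((norm (\<Sum>i<x. g i z))\<^sup>2)) \<partial>M)
      \<le> (\<integral>\<^sup>+z. ennreal ((norm (\<Sum>i=0..<1. g i z))\<^sup>2) \<partial>M)"
    by (intro nn_integral_mono)
  also have "\<dots> \<le> ennreal (\<Sum>i=0..<1. w i)" by (rule 0)
  finally show ?case by (simp add: lessThan_Suc)
next
  case (Suc k)
  note [measurable] = Suc.prems(1)
  define g' where "g' i z = g (2 * i) z + g (Suc (2 * i)) z" for i z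
  define w' where "w' i = w (2 * i) + w (Suc (2 * i))" for i
  have [measurable]: "g' i \<in> borel_measurable M" for i
    unfolding g'_def[abs_def] by measurable
  let ?F = "\<lambda>z. SUP x\<in>{..2 ^ k}. ennreal ((norm (\<Sum>i<x. g' i z))\<^sup>2)"
  \<comment> \<open>For odd x one summand stays unpaired, and which one depends on x. Bounding it by
    the sum of all squares makes the estimate uniform in x, and the integral of that sum is at most
    \<open>W\<close> by the hypothesis on intervals of length one.\<close>
  let ?Q = "\<lambda>z. \<Sum>i<2 ^ Suc k. ennreal ((norm (g i z))\<^sup>2)"
  define W where "W = (\<Sum>i<2 ^ Suc k. w i)"
  have W0: "W \<ge> 0" unfolding W_def by (intro sum_nonneg Suc.prems)
  have W': "(\<Sum>i<2 ^ k. w' i) = W"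
    by (simp add: w'_def W_def sum_pairs_lessThan)
  have IH: "(\<integral>\<^sup>+z. ?F z \<partial>M) \<le> ennreal ((real k + 1)\<^sup>2 * (\<Sum>i<2 ^ k. w' i))"
  proof (rule Suc.IH)
    show "(\<integral>\<^sup>+z. ennreal ((norm (\<Sum>i=m..<n. g' i z))\<^sup>2) \<partial>M) \<le> ennreal (\<Sum>i=m..<n. w' i)" for m n
      using Suc.prems(2)[of "2 * m" "2 * n"] sum_pairs[of "\<lambda>i. g i z" m n for z]
      by (simp add: g'_def w'_def sum_pairs)
  qed (auto simp: w'_def Suc.prems)
  have Q: "(\<integral>\<^sup>+z. ?Q z \<partial>M) \<le> ennreal W"
  proof -
    have "(\<integral>\<^sup>+z. ?Q z \<partial>M) = (\<Sum>i<2 ^ Suc k. \<integral>\<^sup>+z. ennreal ((norm (g i z))\<^sup>2) \<partial>M)"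
      by (rule nn_integral_sum) simp
    also have "\<dots> \<le> (\<Sum>i<2 ^ Suc k. ennreal (w i))"
    proof (rule sum_mono)
      show "(\<integral>\<^sup>+z. ennreal ((norm (g i z))\<^sup>2) \<partial>M) \<le> ennreal (w i)" for i
        using Suc.prems(2)[of i "Suc i"] by simp
    qed
    also have "\<dots> = ennreal W" unfolding W_def by (rule sum_ennreal) (rule Suc.prems)
    finally show ?thesis .
  qed
  have t: "real k + 1 > 0" by simp
  \<comment> \<open>These are the factors of \<open>power2_add_weighted_le\<close> for t = k + 1.
    They satisfy p * (k + 1)^2 + q = (k + 2)^2, the constant required at
    \<open>Suc k\<close>.\<close>
  define p q where "p = (real k + 2) / (real k + 1)" and "q = real k + 2"
  have pq: "p \<ge> 0" "q \<ge> 0" by (auto simp: p_def q_def)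
  have step: "(SUP x\<in>{..2 ^ Suc k}. ennreal ((norm (\<Sum>i<x. g i z))\<^sup>2))
      \<le> ennreal p * ?F z + ennreal q * ?Q z" for z
  proof (rule SUP_least)
    fix x :: nat assume x: "x \<in> {..2 ^ Suc k}"
    define y where "y = x div 2"
    have y: "y \<in> {..2 ^ k}" using x by (auto simp: y_def)
    define a where "a = norm (\<Sum>i<y. g' i z)"
    have a: "a = norm (\<Sum>i<2 * y. g i z)"
      using sum_pairs_lessThan[of "\<lambda>i. g i z" y] by (simp add: a_def g'_def)
    obtain b where b: "norm (\<Sum>i<x. g i z) \<le> a + b" "0 \<le> b" "ennreal (b\<^sup>2) \<le> ?Q z"
    proof (cases "even x")
      case True
      then have "x = 2 * y" by (simp add: y_def)
      then show ?thesis by (intro that[of 0]) (auto simp: a)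
    next
      case False
      then have xy: "x = Suc (2 * y)" by (simp add: y_def)
      have "ennreal ((norm (g (2 * y) z))\<^sup>2) \<le> ?Q z"
        using x xy by (intro member_le_sum) auto
      then show ?thesis
        by (intro that[of "norm (g (2 * y) z)"]) (auto simp: a xy norm_triangle_ineq)
    qed
    have "(norm (\<Sum>i<x. g i z))\<^sup>2 \<le> (a + b)\<^sup>2" using b by (intro power_mono) auto
    also have "\<dots> \<le> p * a\<^sup>2 + q * b\<^sup>2"
      using power2_add_weighted_le[OF t, of a b] by (simp add: p_def q_def add.commute)
    finally have "ennreal ((norm (\<Sum>i<x. g i z))\<^sup>2) \<le> ennreal p * ennreal (a\<^sup>2) + ennreal q * ennreal (b\<^sup>2)"
      using pq by (simp flip: ennreal_mult ennreal_plus)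
    also have "\<dots> \<le> ennreal p * ?F z + ennreal q * ?Q z"
      using b(3) y unfolding a_def by (intro add_mono mult_left_mono SUP_upper) auto
    finally show "ennreal ((norm (\<Sum>i<x. g i z))\<^sup>2) \<le> ennreal p * ?F z + ennreal q * ?Q z" .
  qed
  have "(\<integral>\<^sup>+z. (SUP x\<in>{..2 ^ Suc k}. ennreal ((norm (\<Sum>i<x. g i z))\<^sup>2)) \<partial>M)
      \<le> (\<integral>\<^sup>+z. ennreal p * ?F z + ennreal q * ?Q z \<partial>M)"
    by (intro nn_integral_mono step)
  also have "\<dots> = ennreal p * (\<integral>\<^sup>+z. ?F z \<partial>M) + ennreal q * (\<integral>\<^sup>+z. ?Q z \<partial>M)"
    by (simp add: nn_integral_add nn_integral_cmult)
  also have "\<dots> \<le> ennreal p * ennreal ((real k + 1)\<^sup>2 * W) + ennreal q * ennreal W"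
    using IH Q W' by (intro add_mono mult_left_mono) auto
  also have "\<dots> = ennreal (p * ((real k + 1)\<^sup>2 * W) + q * W)"
    using pq W0 by (simp flip: ennreal_mult ennreal_plus)
  also have "p * ((real k + 1)\<^sup>2 * W) + q * W = (real (Suc k) + 1)\<^sup>2 * W"
    using t by (simp add: p_def q_def power2_eq_square) (simp add: field_simps)
  finally show ?case by (simp add: W_def)
qed

section \<open>From single blocks to all partial sums\<close>

lemma sum_over_dyadic_blocks:
  fixes h :: "nat \<Rightarrow> 'b::comm_monoid_add"
  shows "sum h {1..<2 ^ k} = (\<Sum>j<k. \<Sum>i<2 ^ j. h (2 ^ j + i))"
proof (induction k)
  case (Suc k)
  have "sum h {1..<2 ^ Suc k} = sum h {1..<2 ^ k} + sum h {2 ^ k..<2 ^ Suc k}"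
    by (rule sum.atLeastLessThan_concat[symmetric]) auto
  also have "sum h {2 ^ k..<2 ^ Suc k} = (\<Sum>i<2 ^ k. h (2 ^ k + i))"
    using sum.shift_bounds_nat_ivl[of h 0 "2 ^ k" "2 ^ k"]
    by (simp add: atLeast0LessThan mult_2 add.commute)
  finally show ?case using Suc by simp
qed simp

lemma dyadic_decomposition:
  fixes h :: "nat \<Rightarrow> 'b::comm_monoid_add"
  assumes "N \<ge> 1"
  obtains k x where "x \<le> 2 ^ k"
    "sum h {1..N} = (\<Sum>j<k. \<Sum>i<2 ^ j. h (2 ^ j + i)) + (\<Sum>i<x. h (2 ^ k + i))"
proof -
  define k where "k = floor_log N"
  define x where "x = Suc N - 2 ^ k"
  have k: "2 ^ k \<le> N" "N < 2 ^ Suc k"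
    using assms floor_log_exp2_le[of N] floor_log_exp2_gt[of N] by (auto simp: k_def)
  have "sum h {1..N} = sum h {1..<Suc N}" by (rule sum.cong) auto
  also have "\<dots> = sum h {1..<2 ^ k} + sum h {2 ^ k..<Suc N}"
    using k by (intro sum.atLeastLessThan_concat[symmetric]) auto
  also have "sum h {2 ^ k..<Suc N} = (\<Sum>i<x. h (2 ^ k + i))"
    using sum.shift_bounds_nat_ivl[of h 0 "2 ^ k" x] k
    by (simp add: atLeast0LessThan x_def add.commute)
  finally show ?thesis using k
    by (intro that[of x k]) (simp_all add: x_def sum_over_dyadic_blocks[unfolded One_nat_def])
qed

text \<open>Cauchy--Schwarz after splitting off sqrt (v j). The full series of 1 / v j replaces its
  finite part, so one constant serves every index set, hence every length of partial sum.\<close>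

lemma power2_sum_weighted_le:
  fixes b v :: "nat \<Rightarrow> real"
  assumes "finite J" "\<And>j. v j > 0" "summable (\<lambda>j. 1 / v j)"
  shows "(\<Sum>j\<in>J. b j)\<^sup>2 \<le> suminf (\<lambda>j. 1 / v j) * (\<Sum>j\<in>J. v j * (b j)\<^sup>2)"
proof -
  have "(\<Sum>j\<in>J. b j)\<^sup>2 = (\<Sum>j\<in>J. 1 / sqrt (v j) * (sqrt (v j) * b j))\<^sup>2"
    by (intro arg_cong[where f = "\<lambda>s. s\<^sup>2"] sum.cong) (use assms(2) in \<open>auto simp: less_imp_neq[symmetric]\<close>)
  also have "\<dots> \<le> (\<Sum>j\<in>J. (1 / sqrt (v j))\<^sup>2) * (\<Sum>j\<in>J. (sqrt (v j) * b j)\<^sup>2)"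
    by (rule Cauchy_Schwarz_ineq_sum)
  also have "\<dots> = (\<Sum>j\<in>J. 1 / v j) * (\<Sum>j\<in>J. v j * (b j)\<^sup>2)"
    using assms(2) by (simp add: power_divide power_mult_distrib less_imp_le)
  also have "\<dots> \<le> suminf (\<lambda>j. 1 / v j) * (\<Sum>j\<in>J. v j * (b j)\<^sup>2)"
    using assms by (intro mult_right_mono sum_le_suminf sum_nonneg) (auto simp: less_imp_le)
  finally show ?thesis .
qed

text \<open>The value is pi^2/6, the Cauchy--Schwarz constant for the weights (j + 1)^2.\<close>

definition inv_squares_sum :: real where
  "inv_squares_sum = suminf (\<lambda>j. 1 / (real j + 1)\<^sup>2)"

lemma summable_inv_squares: "summable (\<lambda>j. 1 / (real j + 1)\<^sup>2)"
  using inverse_squares_sums by (simp add: sums_iff add.commute)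

lemma inv_squares_sum_nonneg: "inv_squares_sum \<ge> 0"
  unfolding inv_squares_sum_def by (intro suminf_nonneg summable_inv_squares) auto

lemma maximal_inequality_dyadic:
  fixes c :: "nat \<Rightarrow> 'a \<Rightarrow> 'b::{real_normed_vector, second_countable_topology}"
  assumes [measurable]: "\<And>i. c i \<in> borel_measurable M"
    and bound: "\<And>m n. (\<integral>\<^sup>+z. ennreal ((norm (\<Sum>i=m..<n. c i z))\<^sup>2) \<partial>M) \<le> ennreal (\<Sum>i=m..<n. w i)"
    and w: "\<And>i. w i \<ge> 0"
  shows "(\<integral>\<^sup>+z. (SUP N\<in>{1..}. ennreal (norm (\<Sum>n=1..N. c n z)))\<^sup>2 \<partial>M)
    \<le> ennreal inv_squares_sum * suminf (\<lambda>j. ennreal ((real j + 1) ^ 4 * (\<Sum>i<2 ^ j. w (2 ^ j + i))))"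
proof -
  define G where "G j z = (SUP x\<in>{..2 ^ j}. ennreal ((norm (\<Sum>i<x. c (2 ^ j + i) z))\<^sup>2))" for j :: nat and z
  have [measurable]: "G j \<in> borel_measurable M" for j
    unfolding G_def[abs_def] by measurable
  have G: "(\<integral>\<^sup>+z. G j z \<partial>M) \<le> ennreal ((real j + 1)\<^sup>2 * (\<Sum>i<2 ^ j. w (2 ^ j + i)))" for j
    unfolding G_def
  proof (rule rademacher_menchoff)
    fix m n
    show "(\<integral>\<^sup>+z. ennreal ((norm (\<Sum>i=m..<n. c (2 ^ j + i) z))\<^sup>2) \<partial>M)
        \<le> ennreal (\<Sum>i=m..<n. w (2 ^ j + i))"
      using bound[of "m + 2 ^ j" "n + 2 ^ j"]
      by (simp only: sum.shift_bounds_nat_ivl add.commute[of "2 ^ j"])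
  qed (auto simp: w)
  have pointwise: "(SUP N\<in>{1..}. ennreal (norm (\<Sum>n=1..N. c n z)))\<^sup>2
      \<le> ennreal inv_squares_sum * suminf (\<lambda>j. ennreal ((real j + 1)\<^sup>2) * G j z)" for z
  proof -
    have "(ennreal (norm (\<Sum>n=1..N. c n z)))\<^sup>2
        \<le> ennreal inv_squares_sum * suminf (\<lambda>j. ennreal ((real j + 1)\<^sup>2) * G j z)" if N: "N \<ge> 1" for N
    proof -
      obtain k x where x: "x \<le> 2 ^ k" and
        eq: "(\<Sum>n=1..N. c n z) = (\<Sum>j<k. \<Sum>i<2 ^ j. c (2 ^ j + i) z) + (\<Sum>i<x. c (2 ^ k + i) z)"
        by (rule dyadic_decomposition[OF N, of "\<lambda>n. c n z"])
      define e where "e j = (if j < k then 2 ^ j else x)" for j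
      define b where "b j = norm (\<Sum>i<e j. c (2 ^ j + i) z)" for j
      have b: "ennreal ((b j)\<^sup>2) \<le> G j z" if "j \<le> k" for j
        unfolding b_def G_def using that x by (intro SUP_upper) (auto simp: e_def)
      have "norm (\<Sum>n=1..N. c n z) \<le> (\<Sum>j\<le>k. b j)"
      proof -
        have "(\<Sum>n=1..N. c n z) = (\<Sum>j\<le>k. \<Sum>i<e j. c (2 ^ j + i) z)"
          unfolding eq by (simp add: e_def lessThan_Suc_atMost[symmetric])
        then show ?thesis by (simp add: b_def norm_sum)
      qed
      then have "(norm (\<Sum>n=1..N. c n z))\<^sup>2 \<le> (\<Sum>j\<le>k. b j)\<^sup>2"
        by (intro power_mono) auto
      also have "\<dots> \<le> inv_squares_sum * (\<Sum>j\<le>k. (real j + 1)\<^sup>2 * (b j)\<^sup>2)"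
        unfolding inv_squares_sum_def
        by (rule power2_sum_weighted_le) (auto intro: summable_inv_squares)
      finally have le: "(norm (\<Sum>n=1..N. c n z))\<^sup>2
          \<le> inv_squares_sum * (\<Sum>j\<le>k. (real j + 1)\<^sup>2 * (b j)\<^sup>2)" .
      have sum_eq: "(\<Sum>j\<le>k. ennreal ((real j + 1)\<^sup>2) * ennreal ((b j)\<^sup>2))
          = ennreal (\<Sum>j\<le>k. (real j + 1)\<^sup>2 * (b j)\<^sup>2)"
        by (subst sum_ennreal[symmetric]) (auto simp: ennreal_mult)
      have "ennreal ((norm (\<Sum>n=1..N. c n z))\<^sup>2)
          \<le> ennreal inv_squares_sum * (\<Sum>j\<le>k. ennreal ((real j + 1)\<^sup>2) * ennreal ((b j)\<^sup>2))"
        unfolding sum_eq by (subst ennreal_mult'[symmetric]) (rule inv_squares_sum_nonneg, rule ennreal_leI, rule le)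
      also have "\<dots> \<le> ennreal inv_squares_sum * (\<Sum>j\<le>k. ennreal ((real j + 1)\<^sup>2) * G j z)"
        by (intro mult_left_mono sum_mono b) auto
      also have "\<dots> \<le> ennreal inv_squares_sum * suminf (\<lambda>j. ennreal ((real j + 1)\<^sup>2) * G j z)"
        by (intro mult_left_mono sum_le_suminf) auto
      finally show ?thesis by (simp add: ennreal_power)
    qed
    then show ?thesis
      by (intro order_trans[OF power2_SUP_ennreal] SUP_least) auto
  qed
  have "(\<integral>\<^sup>+z. (SUP N\<in>{1..}. ennreal (norm (\<Sum>n=1..N. c n z)))\<^sup>2 \<partial>M)
      \<le> (\<integral>\<^sup>+z. ennreal inv_squares_sum * suminf (\<lambda>j. ennreal ((real j + 1)\<^sup>2) * G j z) \<partial>M)"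
    by (intro nn_integral_mono pointwise)
  also have "\<dots> = ennreal inv_squares_sum * suminf (\<lambda>j. ennreal ((real j + 1)\<^sup>2) * (\<integral>\<^sup>+z. G j z \<partial>M))"
    by (simp add: nn_integral_cmult nn_integral_suminf)
  also have "\<dots> \<le> ennreal inv_squares_sum *
      suminf (\<lambda>j. ennreal ((real j + 1)\<^sup>2) * ennreal ((real j + 1)\<^sup>2 * (\<Sum>i<2 ^ j. w (2 ^ j + i))))"
    by (intro mult_left_mono suminf_le G) auto
  also have "\<dots> = ennreal inv_squares_sum * suminf (\<lambda>j. ennreal ((real j + 1) ^ 4 * (\<Sum>i<2 ^ j. w (2 ^ j + i))))"
    by (intro arg_cong2[where f = "(*)"] suminf_cong refl)
       (simp add: power2_eq_square power4_eq_xxxx mult.assoc flip: ennreal_mult')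
  finally show ?thesis .
qed

text \<open>Exponential decay beats the quartic loss. Boundedness in j is enough, without
  summability, because the squared coefficients are themselves summed over all blocks by Bessel's
  inequality.\<close>

lemma polynomial_exponential_bounded:
  fixes u :: real
  assumes "u > 0"
  shows "\<exists>B>0. \<forall>j::nat. (real j + 1) ^ 4 * (2 ^ j) powr (- (2 * u)) \<le> B"
proof -
  have "(\<lambda>j::nat. (real j + 1) ^ 4 * (2 ^ j) powr (- (2 * u))) \<longlonglongrightarrow> 0"
    using assms by real_asymp
  then have "Bseq (\<lambda>j::nat. (real j + 1) ^ 4 * (2 ^ j) powr (- (2 * u)))"
    by (rule convergent_imp_Bseq[OF convergentI])
  then obtain B where "B > 0" "\<And>j::nat. norm ((real j + 1) ^ 4 * (2 ^ j) powr (- (2 * u))) \<le> B"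
    by (auto elim: BseqE)
  then show ?thesis by (auto simp: abs_mult)
qed

section \<open>Orthonormality of the monomials and Bessel's inequality\<close>

lemma component_measurable_haar_Tinf [measurable]:
  "(\<lambda>z. z k) \<in> borel_measurable haar_Tinf"
proof -
  have "(\<lambda>z. z k) \<in> haar_Tinf \<rightarrow>\<^sub>M circle_haar"
    unfolding haar_Tinf_def by (rule measurable_component_singleton) simp
  also have "haar_Tinf \<rightarrow>\<^sub>M circle_haar = haar_Tinf \<rightarrow>\<^sub>M restrict_space borel torus"
    by (rule measurable_cong_sets[OF refl sets_circle_haar])
  finally show ?thesis
    by (simp add: measurable_restrict_space2_iff)
qed

lemma zpow_measurable [measurable]: "(\<lambda>z. zpow z \<alpha>) \<in> borel_measurable haar_Tinf"
  unfolding zpow_def power_int_def by measurable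

lemma borel_measurable_cnj [measurable]: "cnj \<in> borel_measurable borel"
  by (intro borel_measurable_continuous_onI continuous_intros)

lemma zpow_superset:
  assumes "finite A" "Poly_Mapping.keys \<alpha> \<subseteq> A"
  shows "zpow z \<alpha> = (\<Prod>k\<in>A. z k powi Poly_Mapping.lookup \<alpha> k)"
  unfolding zpow_def by (rule prod.mono_neutral_left) (use assms in \<open>auto simp: in_keys_iff\<close>)

lemma norm_zpow:
  assumes "z \<in> space haar_Tinf"
  shows "norm (zpow z \<alpha>) = 1"
  using assms by (simp add: zpow_def space_haar_Tinf norm_power_int flip: prod_norm)

text \<open>Conjugation is inversion on the circle, so exponents subtract. Orthogonality thereby
  reduces to the integral of a single monomial.\<close>

lemma zpow_mult_cnj:
  assumes "z \<in> space haar_Tinf"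
  shows "zpow z \<alpha> * cnj (zpow z \<beta>) = zpow z (\<alpha> - \<beta>)"
proof -
  define A where "A = Poly_Mapping.keys \<alpha> \<union> Poly_Mapping.keys \<beta> \<union> Poly_Mapping.keys (\<alpha> - \<beta>)"
  have A: "finite A" "Poly_Mapping.keys \<alpha> \<subseteq> A" "Poly_Mapping.keys \<beta> \<subseteq> A"
    "Poly_Mapping.keys (\<alpha> - \<beta>) \<subseteq> A"
    by (auto simp: A_def)
  have z: "norm (z k) = 1" for k using assms by (simp add: space_haar_Tinf)
  have z0: "z k \<noteq> 0" for k using z[of k] by auto
  have "cnj (z k powi m) = inverse (z k powi m)" for k m
    by (rule inverse_unique[symmetric]) (simp only: complex_norm_square[symmetric] norm_power_int z power_int_1_left, simp)
  then have eq: "z k powi m * cnj (z k powi n) = z k powi (m - n)" for k m n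
    by (simp add: power_int_diff z0 divide_inverse)
  show ?thesis
    unfolding zpow_superset[OF A(1,2)] zpow_superset[OF A(1,3)] zpow_superset[OF A(1,4)]
    by (simp only: cnj_prod prod.distrib[symmetric] eq lookup_minus)
qed

lemma integrable_bounded_haar_Tinf:
  fixes f :: "(nat \<Rightarrow> complex) \<Rightarrow> complex"
  assumes "f \<in> borel_measurable haar_Tinf" "\<And>z. z \<in> space haar_Tinf \<Longrightarrow> norm (f z) \<le> B"
  shows "integrable haar_Tinf f"
proof -
  interpret prob_space haar_Tinf by (rule prob_space_haar_Tinf)
  show ?thesis using assms by (intro integrable_const_bound[where B = B]) auto
qed

text \<open>Rotating one coordinate by a suitable \<open>w\<close> with \<open>w\<^sup>m = -1\<close> negates the monomial.\<close>

lemma integral_zpow: "(LINT z|haar_Tinf. zpow z \<alpha>) = (if \<alpha> = 0 then 1 else 0)"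
proof (cases "\<alpha> = 0")
  case True
  interpret prob_space haar_Tinf by (rule prob_space_haar_Tinf)
  show ?thesis using True by (simp add: zpow_def prob_space)
next
  case False
  then obtain k where k: "Poly_Mapping.lookup \<alpha> k \<noteq> 0"
    by (metis lookup_zero poly_mapping_eqI)
  define m where "m = Poly_Mapping.lookup \<alpha> k"
  \<comment> \<open>The exponent m is nonzero, so pi / m makes sense, and the m-th power is cis pi =
    -1 for either sign of m.\<close>
  define w where "w = (\<lambda>j. if j = k then cis (pi / of_int m) else 1)"
  have w: "w \<in> space haar_Tinf" by (auto simp: w_def space_haar_Tinf)
  have "w k powi m = -1"
    using k by (simp add: w_def m_def cis_power_int)
  moreover have "zpow w \<alpha> = w k powi m"
    unfolding zpow_def m_def
    by (subst prod.remove[of _ k]) (use k in \<open>auto simp: in_keys_iff w_def\<close>)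
  ultimately have neg: "zpow (\<lambda>j. w j * z j) \<alpha> = - zpow z \<alpha>" for z
    by (simp add: zpow_def power_int_mult_distrib prod.distrib)
  have meas: "(\<lambda>z k. w k * z k) \<in> haar_Tinf \<rightarrow>\<^sub>M haar_Tinf"
    unfolding haar_Tinf_def
  proof (rule measurable_PiM_single')
    have wj: "w j \<in> torus" for j using w by (simp add: space_haar_Tinf)
    show "(\<lambda>z. w j * z j) \<in> PiM UNIV (\<lambda>_. circle_haar) \<rightarrow>\<^sub>M circle_haar" for j :: nat
      using rotation_measurable[OF wj[of j]]
      by (rule measurable_compose[rotated]) (rule measurable_component_singleton, simp)
    show "(\<lambda>z j. w j * z j)
            \<in> space (PiM UNIV (\<lambda>_. circle_haar)) \<rightarrow> (UNIV \<rightarrow>\<^sub>E space circle_haar)"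
      using wj by (auto simp: space_PiM space_circle_haar PiE_iff norm_mult)
  qed
  have "(LINT z|haar_Tinf. zpow z \<alpha>) = (LINT z|distr haar_Tinf haar_Tinf (\<lambda>z k. w k * z k). zpow z \<alpha>)"
    by (simp add: haar_Tinf_invariant[OF w])
  also have "\<dots> = (LINT z|haar_Tinf. zpow (\<lambda>j. w j * z j) \<alpha>)"
    by (rule integral_distr[OF meas]) simp
  also have "\<dots> = - (LINT z|haar_Tinf. zpow z \<alpha>)" by (simp add: neg)
  finally show ?thesis using False by simp
qed

lemma zpow_orthonormal:
  "(LINT z|haar_Tinf. zpow z \<alpha> * cnj (zpow z \<beta>)) = (if \<alpha> = \<beta> then 1 else 0)"
proof -
  have "(LINT z|haar_Tinf. zpow z \<alpha> * cnj (zpow z \<beta>)) = (LINT z|haar_Tinf. zpow z (\<alpha> - \<beta>))"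
    by (rule Bochner_Integration.integral_cong) (auto simp: zpow_mult_cnj)
  then show ?thesis by (simp add: integral_zpow)
qed

text \<open>The squared norm is written as P * cnj P so that it expands bilinearly into orthonormal
  pairs; real parts recover the real-valued form afterwards.\<close>

lemma integral_trig_poly_mult_cnj:
  assumes "finite F"
  shows "(LINT z|haar_Tinf. (\<Sum>\<alpha>\<in>F. b \<alpha> * zpow z \<alpha>) * cnj (\<Sum>\<alpha>\<in>F. b \<alpha> * zpow z \<alpha>))
           = of_real (\<Sum>\<alpha>\<in>F. (norm (b \<alpha>))\<^sup>2)"
proof -
  have int: "integrable haar_Tinf (\<lambda>z. zpow z \<alpha> * cnj (zpow z \<beta>))" for \<alpha> \<beta>
    by (rule integrable_bounded_haar_Tinf[where B = 1]) (auto simp: norm_mult norm_zpow)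
  have "(LINT z|haar_Tinf. (\<Sum>\<alpha>\<in>F. b \<alpha> * zpow z \<alpha>) * cnj (\<Sum>\<alpha>\<in>F. b \<alpha> * zpow z \<alpha>))
      = (LINT z|haar_Tinf. (\<Sum>\<alpha>\<in>F. \<Sum>\<beta>\<in>F. (b \<alpha> * cnj (b \<beta>)) * (zpow z \<alpha> * cnj (zpow z \<beta>))))"
    by (simp add: sum_product mult_ac)
  also have "\<dots> = (\<Sum>\<alpha>\<in>F. \<Sum>\<beta>\<in>F. (b \<alpha> * cnj (b \<beta>)) * (if \<alpha> = \<beta> then 1 else 0))"
    by (simp add: int zpow_orthonormal)
  also have "\<dots> = (\<Sum>\<alpha>\<in>F. b \<alpha> * cnj (b \<alpha>))"
    using assms by (simp add: if_distrib cong: if_cong)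
  also have "\<dots> = of_real (\<Sum>\<alpha>\<in>F. (norm (b \<alpha>))\<^sup>2)"
    by (simp only: of_real_sum complex_norm_square)
  finally show ?thesis .
qed

lemma trig_poly_bound:
  assumes "z \<in> space haar_Tinf"
  shows "norm (\<Sum>\<alpha>\<in>F. b \<alpha> * zpow z \<alpha>) \<le> (\<Sum>\<alpha>\<in>F. norm (b \<alpha>))"
  by (rule order_trans[OF norm_sum]) (simp add: norm_mult norm_zpow[OF assms])

lemma integrable_trig_poly_norm2:
  "integrable haar_Tinf (\<lambda>z. (\<Sum>\<alpha>\<in>F. b \<alpha> * zpow z \<alpha>) * cnj (\<Sum>\<alpha>\<in>F. b \<alpha> * zpow z \<alpha>))"
proof (rule integrable_bounded_haar_Tinf)
  fix z assume "z \<in> space haar_Tinf"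
  then show "norm ((\<Sum>\<alpha>\<in>F. b \<alpha> * zpow z \<alpha>) * cnj (\<Sum>\<alpha>\<in>F. b \<alpha> * zpow z \<alpha>))
      \<le> (\<Sum>\<alpha>\<in>F. norm (b \<alpha>)) * (\<Sum>\<alpha>\<in>F. norm (b \<alpha>))"
    unfolding norm_mult complex_mod_cnj by (intro mult_mono trig_poly_bound sum_nonneg) auto
qed simp

text \<open>This supplies the hypothesis on consecutive sums in the maximal inequality, with the
  squared coefficients as weights.\<close>

lemma nn_integral_trig_poly_norm2:
  assumes "finite F"
  shows "(\<integral>\<^sup>+z. ennreal ((norm (\<Sum>\<alpha>\<in>F. b \<alpha> * zpow z \<alpha>))\<^sup>2) \<partial>haar_Tinf)
           = ennreal (\<Sum>\<alpha>\<in>F. (norm (b \<alpha>))\<^sup>2)"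
proof -
  let ?P = "\<lambda>z. \<Sum>\<alpha>\<in>F. b \<alpha> * zpow z \<alpha>"
  have eq: "(norm (?P z))\<^sup>2 = Re (?P z * cnj (?P z))" for z
    by (metis Re_complex_of_real complex_norm_square)
  have "(\<integral>\<^sup>+z. ennreal ((norm (?P z))\<^sup>2) \<partial>haar_Tinf) = ennreal (LINT z|haar_Tinf. (norm (?P z))\<^sup>2)"
  proof (rule nn_integral_eq_integral)
    show "integrable haar_Tinf (\<lambda>z. (norm (?P z))\<^sup>2)"
      unfolding eq by (intro integrable_Re integrable_trig_poly_norm2)
  qed simp
  also have "(LINT z|haar_Tinf. (norm (?P z))\<^sup>2) = Re (LINT z|haar_Tinf. ?P z * cnj (?P z))"
    unfolding eq by (rule integral_Re[OF integrable_trig_poly_norm2])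
  also have "\<dots> = (\<Sum>\<alpha>\<in>F. (norm (b \<alpha>))\<^sup>2)"
    by (simp only: integral_trig_poly_mult_cnj[OF assms] Re_complex_of_real)
  finally show ?thesis .
qed

lemma Lp_Tinf_2_iff:
  "f \<in> Lp_Tinf 2 \<longleftrightarrow> f \<in> borel_measurable haar_Tinf \<and> integrable haar_Tinf (\<lambda>z. (norm (f z))\<^sup>2)"
  by (simp add: Lp_Tinf_def powr_numeral)

lemma Lp_norm_2_power2: "(Lp_norm 2 f)\<^sup>2 = (LINT z|haar_Tinf. (norm (f z))\<^sup>2)"
proof -
  have "(LINT z|haar_Tinf. (norm (f z))\<^sup>2) \<ge> 0" by simp
  then show ?thesis by (simp add: Lp_norm_def powr_numeral powr_half_sqrt)
qed

text \<open>With P the Fourier sum of f over F and S the sum of the squared coefficients, expanding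
  the integral of |f - P|^2 gives |f|^2 - 2 * S + S in integrated form, which is
  nonnegative.\<close>

lemma bessel_inequality:
  assumes f: "f \<in> Lp_Tinf 2" and F: "finite F"
  shows "(\<Sum>\<alpha>\<in>F. (norm (fourier_coeff f \<alpha>))\<^sup>2) \<le> (Lp_norm 2 f)\<^sup>2"
proof -
  interpret prob_space haar_Tinf by (rule prob_space_haar_Tinf)
  have [measurable]: "f \<in> borel_measurable haar_Tinf" and f2: "integrable haar_Tinf (\<lambda>z. (norm (f z))\<^sup>2)"
    using f by (auto simp: Lp_Tinf_2_iff)
  let ?b = "fourier_coeff f"
  let ?P = "\<lambda>z. \<Sum>\<alpha>\<in>F. ?b \<alpha> * zpow z \<alpha>"
  let ?S = "\<Sum>\<alpha>\<in>F. (norm (?b \<alpha>))\<^sup>2"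
  have fz: "integrable haar_Tinf (\<lambda>z. f z * cnj (zpow z \<alpha>))" for \<alpha>
  proof (rule Bochner_Integration.integrable_bound)
    show "integrable haar_Tinf (\<lambda>z. 1 + (norm (f z))\<^sup>2)" using f2 by simp
    \<comment> \<open>The measure is finite, so 1 + |f|^2 is an integrable majorant of |f|; this
      makes the Fourier integrals of a square-integrable f converge.\<close>
    have "t \<le> 1 + t\<^sup>2" for t :: real
      using zero_le_power2[of "t - 1 / 2"] by (simp add: power2_eq_square algebra_simps)
    then show "AE z in haar_Tinf. norm (f z * cnj (zpow z \<alpha>)) \<le> norm (1 + (norm (f z))\<^sup>2)"
      by (intro AE_I2) (simp add: norm_mult norm_zpow)
  qed simp
  have fP_eq: "f z * cnj (?P z) = (\<Sum>\<alpha>\<in>F. cnj (?b \<alpha>) * (f z * cnj (zpow z \<alpha>)))" for z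
    by (simp add: sum_distrib_left mult_ac)
  have fP: "integrable haar_Tinf (\<lambda>z. f z * cnj (?P z))"
    unfolding fP_eq by (intro Bochner_Integration.integrable_sum integrable_mult_right fz)
  have "(LINT z|haar_Tinf. f z * cnj (?P z)) = (\<Sum>\<alpha>\<in>F. cnj (?b \<alpha>) * ?b \<alpha>)"
    unfolding fP_eq by (simp add: fz fourier_coeff_def)
  also have "\<dots> = of_real ?S" by (simp only: of_real_sum complex_norm_square mult.commute)
  finally have fP_int: "(LINT z|haar_Tinf. f z * cnj (?P z)) = of_real ?S" .
  have "(norm (v - w))\<^sup>2 = (norm v)\<^sup>2 - 2 * Re (v * cnj w) + Re (w * cnj w)" for v w :: complex
    by (simp only: cmod_power2) (simp add: power2_eq_square algebra_simps)
  then have eq: "(norm (f z - ?P z))\<^sup>2 = (norm (f z))\<^sup>2 - 2 * Re (f z * cnj (?P z)) + Re (?P z * cnj (?P z))" for z .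
  have "0 \<le> (LINT z|haar_Tinf. (norm (f z - ?P z))\<^sup>2)" by simp
  also have "\<dots> = (LINT z|haar_Tinf. (norm (f z))\<^sup>2) - 2 * Re (LINT z|haar_Tinf. f z * cnj (?P z))
      + Re (LINT z|haar_Tinf. ?P z * cnj (?P z))"
    unfolding eq using f2 integrable_Re[OF fP] integrable_Re[OF integrable_trig_poly_norm2[where F = F and b = ?b]]
    by (simp only: Bochner_Integration.integral_add Bochner_Integration.integral_diff
        Bochner_Integration.integrable_diff integrable_mult_right integral_mult_right_zero
        integral_Re[OF fP] integral_Re[OF integrable_trig_poly_norm2])
  also have "\<dots> = (Lp_norm 2 f)\<^sup>2 - ?S"
    unfolding fP_int integral_trig_poly_mult_cnj[OF F] by (simp add: Lp_norm_2_power2)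
  finally show ?thesis by simp
qed

section \<open>Unique factorization as a bijection between positive integers and exponent
  sequences\<close>

text \<open>A natural-number counterpart of the real-valued \<open>ppow\<close>, agreeing with it on
  \<open>nonneg_idx\<close>. Negative exponents are truncated to 0, which keeps the value
  positive.\<close>

definition nat_of_exponents :: "(nat \<Rightarrow>\<^sub>0 int) \<Rightarrow> nat" where
  "nat_of_exponents \<alpha> = (\<Prod>k\<in>Poly_Mapping.keys \<alpha>. prime_seq k ^ nat (Poly_Mapping.lookup \<alpha> k))"

text \<open>Since \<open>multiplicity\<close> returns 0 on the argument 0, the integers 0 and 1
  share the zero sequence; the correspondence is a bijection only from 1 on.\<close>

definition prime_exponents :: "nat \<Rightarrow> (nat \<Rightarrow>\<^sub>0 int)" where
  "prime_exponents n = Abs_poly_mapping (\<lambda>k. int (multiplicity (prime_seq k) n))"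

lemma inj_prime_seq: "inj prime_seq"
  using bij_prime_seq by (simp add: bij_betw_def)

lemma prime_prime_seq: "prime (prime_seq k)"
  using bij_betwE[OF bij_prime_seq] by auto

lemma lookup_prime_exponents:
  "Poly_Mapping.lookup (prime_exponents n) k = int (multiplicity (prime_seq k) n)"
proof -
  have "finite {k. int (multiplicity (prime_seq k) n) \<noteq> 0}"
  proof (rule finite_subset)
    show "{k. int (multiplicity (prime_seq k) n) \<noteq> 0} \<subseteq> prime_seq -` prime_factors n"
      using prime_prime_seq by (auto simp: prime_factors_multiplicity)
    show "finite (prime_seq -` prime_factors n)"
      by (intro finite_vimageI inj_prime_seq) simp
  qed
  then show ?thesis by (simp add: prime_exponents_def)
qed

lemma prime_exponents_nonneg: "prime_exponents n \<in> nonneg_idx"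
  by (simp add: nonneg_idx_def lookup_prime_exponents)

lemma nat_of_exponents_prime_exponents:
  assumes "n \<ge> 1"
  shows "nat_of_exponents (prime_exponents n) = n"
proof -
  have "bij_betw prime_seq (Poly_Mapping.keys (prime_exponents n)) (prime_factors n)"
  proof (rule bij_betw_imageI)
    show "inj_on prime_seq (Poly_Mapping.keys (prime_exponents n))"
      by (rule inj_on_subset[OF inj_prime_seq]) simp
    have "prime_seq ` Poly_Mapping.keys (prime_exponents n) = {p \<in> range prime_seq. multiplicity p n > 0}"
      by (auto simp: in_keys_iff lookup_prime_exponents)
    also have "\<dots> = prime_factors n"
      using bij_betw_imp_surj_on[OF bij_prime_seq] by (simp add: prime_factors_multiplicity)
    finally show "prime_seq ` Poly_Mapping.keys (prime_exponents n) = prime_factors n" .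
  qed
  from prod.reindex_bij_betw[OF this, of "\<lambda>p. p ^ multiplicity p n"]
  show ?thesis
    using prime_factorization_nat[of n] assms
    by (simp add: nat_of_exponents_def lookup_prime_exponents)
qed

text \<open>Uniqueness of factorization: in a product of powers of distinct primes, the multiplicity
  of each prime is its exponent.\<close>

lemma prime_exponents_nat_of_exponents:
  assumes "\<alpha> \<in> nonneg_idx"
  shows "prime_exponents (nat_of_exponents \<alpha>) = \<alpha>"
proof (rule poly_mapping_eqI)
  fix k
  let ?K = "Poly_Mapping.keys \<alpha>"
  have "nat_of_exponents \<alpha> =
      (\<Prod>p\<in>prime_seq ` ?K. p ^ nat (Poly_Mapping.lookup \<alpha> (the_inv prime_seq p)))"
    unfolding nat_of_exponents_def
    by (subst prod.reindex) (auto simp: the_inv_f_f[OF inj_prime_seq] intro: inj_on_subset[OF inj_prime_seq])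
  moreover have "multiplicity (prime_seq k) \<dots>
      = (if prime_seq k \<in> prime_seq ` ?K then nat (Poly_Mapping.lookup \<alpha> k) else 0)"
    by (subst multiplicity_prod_prime_powers)
       (auto simp: prime_prime_seq the_inv_f_f[OF inj_prime_seq])
  moreover have "Poly_Mapping.lookup \<alpha> k \<ge> 0" using assms by (simp add: nonneg_idx_def)
  ultimately show "Poly_Mapping.lookup (prime_exponents (nat_of_exponents \<alpha>)) k = Poly_Mapping.lookup \<alpha> k"
    by (simp add: lookup_prime_exponents inj_image_mem_iff[OF inj_prime_seq] in_keys_iff)
qed

lemma nat_of_exponents_pos: "nat_of_exponents \<alpha> \<ge> 1"
proof -
  have "nat_of_exponents \<alpha> > 0"
    unfolding nat_of_exponents_def by (intro prod_pos) (simp add: prime_gt_0_nat prime_prime_seq)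
  then show ?thesis by simp
qed

lemma ppow_eq_nat_of_exponents:
  assumes "\<alpha> \<in> nonneg_idx"
  shows "ppow \<alpha> = real (nat_of_exponents \<alpha>)"
  using assms by (simp add: ppow_def nat_of_exponents_def nonneg_idx_def power_int_nonneg_exp)

lemma ppow_prime_exponents: "n \<ge> 1 \<Longrightarrow> ppow (prime_exponents n) = real n"
  by (simp add: ppow_eq_nat_of_exponents prime_exponents_nonneg nat_of_exponents_prime_exponents)

lemma bij_betw_prime_exponents: "bij_betw prime_exponents {1..} nonneg_idx"
  by (rule bij_betw_byWitness[where f' = nat_of_exponents])
     (auto simp: nat_of_exponents_prime_exponents prime_exponents_nat_of_exponents
        prime_exponents_nonneg nat_of_exponents_pos simp del: One_nat_def)

lemma inj_on_prime_exponents: "inj_on prime_exponents {1..}"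
  using bij_betw_prime_exponents by (simp add: bij_betw_def)

text \<open>The strict bound n < x means that n is at most the ceiling of x minus 1. For x at most 1
  both sums are empty.\<close>

lemma sum_ppow_less:
  fixes h :: "(nat \<Rightarrow>\<^sub>0 int) \<Rightarrow> 'b::comm_monoid_add"
  assumes "x > 0"
  shows "(\<Sum>\<alpha> | \<alpha> \<in> nonneg_idx \<and> ppow \<alpha> < x. h \<alpha>) = (\<Sum>n=1..nat (\<lceil>x\<rceil> - 1). h (prime_exponents n))"
proof -
  have iff: "n \<le> nat (\<lceil>x\<rceil> - 1) \<longleftrightarrow> real n < x" if "n \<ge> 1" for n
  proof -
    have "n \<le> nat (\<lceil>x\<rceil> - 1) \<longleftrightarrow> int n < \<lceil>x\<rceil>" using that by linarith
    also have "\<dots> \<longleftrightarrow> real n < x" by (simp add: less_ceiling_iff)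
    finally show ?thesis .
  qed
  have "bij_betw prime_exponents {1..nat (\<lceil>x\<rceil> - 1)} {\<alpha>. \<alpha> \<in> nonneg_idx \<and> ppow \<alpha> < x}"
  proof (rule bij_betw_imageI)
    show "inj_on prime_exponents {1..nat (\<lceil>x\<rceil> - 1)}"
      by (rule inj_on_subset[OF inj_on_prime_exponents]) auto
    have "\<alpha> \<in> prime_exponents ` {1..nat (\<lceil>x\<rceil> - 1)}" if "\<alpha> \<in> nonneg_idx" "ppow \<alpha> < x" for \<alpha>
      using that iff[OF nat_of_exponents_pos[of \<alpha>]] nat_of_exponents_pos[of \<alpha>]
      by (intro image_eqI[of _ _ "nat_of_exponents \<alpha>"])
         (auto simp: prime_exponents_nat_of_exponents ppow_eq_nat_of_exponents)
    then show "prime_exponents ` {1..nat (\<lceil>x\<rceil> - 1)} = {\<alpha>. \<alpha> \<in> nonneg_idx \<and> ppow \<alpha> < x}"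
      using iff by (auto simp: prime_exponents_nonneg ppow_prime_exponents)
  qed
  then show ?thesis by (rule sum.reindex_bij_betw[symmetric])
qed

section \<open>Values of characters as monomials\<close>

lemma Xi_power:
  assumes "\<xi> \<in> Xi" "m \<ge> 1"
  shows "\<xi> (m ^ e) = \<xi> m ^ e"
proof (induction e)
  case 0
  then show ?case using Xi_one[OF assms(1)] by simp
next
  case (Suc e)
  then show ?case using Xi_mult[OF assms(1), of m "m ^ e"] assms(2) by simp
qed

lemma Xi_prod:
  assumes "\<xi> \<in> Xi" "\<And>i. i \<in> A \<Longrightarrow> f i \<ge> 1"
  shows "\<xi> (\<Prod>i\<in>A. f i) = (\<Prod>i\<in>A. \<xi> (f i))"
  using assms(2)
proof (induction A rule: infinite_finite_induct)
  case (insert i A)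
  have "(\<Prod>i\<in>A. f i) \<ge> 1" using insert.prems by (intro prod_ge_1) auto
  from Xi_mult[OF assms(1) _ this, of "f i"] show ?case
    using insert by simp
qed (use Xi_one[OF assms(1)] in auto)

text \<open>Complete multiplicativity along the prime factorization of n. It turns partial sums of a
  twisted Dirichlet series into trigonometric polynomials on the polytorus.\<close>

lemma Xi_eq_zpow:
  assumes "\<xi> \<in> Xi" "n \<ge> 1"
  shows "\<xi> n = zpow (Xi_iso \<xi>) (prime_exponents n)"
proof -
  have p: "prime_seq k \<ge> 1" for k using prime_gt_0_nat[OF prime_prime_seq[of k]] by simp
  then have pe: "prime_seq k ^ e \<ge> 1" for k e by simp
  have "\<xi> n = \<xi> (nat_of_exponents (prime_exponents n))"
    using assms(2) by (simp add: nat_of_exponents_prime_exponents)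
  also have "\<dots> = zpow (Xi_iso \<xi>) (prime_exponents n)"
    unfolding nat_of_exponents_def Xi_prod[OF assms(1) pe] Xi_power[OF assms(1) p] zpow_def
    by (simp add: Xi_iso_def lookup_prime_exponents)
  finally show ?thesis .
qed

section \<open>The maximal inequality on the polytorus\<close>

lemma maximal_inequality_Tinf:
  fixes u :: real
  assumes u: "u > 0"
  shows "\<exists>C>0. \<forall>f\<in>Lp_Tinf 2.
    (\<integral>\<^sup>+z. (SUP N\<in>{1..}. ennreal (norm (\<Sum>n=1..N.
        fourier_coeff f (prime_exponents n) / of_real (real n powr u) * zpow z (prime_exponents n))))\<^sup>2
      \<partial>haar_Tinf) \<le> ennreal ((C * Lp_norm 2 f)\<^sup>2)"
proof -
  obtain B where B: "B > 0" "\<And>j::nat. (real j + 1) ^ 4 * (2 ^ j) powr (- (2 * u)) \<le> B"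
    using polynomial_exponential_bounded[OF u] by blast
  define K where "K = inv_squares_sum * B"
  have K: "K \<ge> 0" using B inv_squares_sum_nonneg by (simp add: K_def)
  \<comment> \<open>Adding 1 gives C > 0 from K >= 0 alone, and still K <= C^2.\<close>
  define C where "C = sqrt K + 1"
  have "sqrt K \<ge> 0" using K by simp
  then have C: "C > 0" "K \<le> C\<^sup>2"
    using K unfolding C_def by (linarith, simp add: power2_sum)
  have "(\<integral>\<^sup>+z. (SUP N\<in>{1..}. ennreal (norm (\<Sum>n=1..N.
        fourier_coeff f (prime_exponents n) / of_real (real n powr u) * zpow z (prime_exponents n))))\<^sup>2
      \<partial>haar_Tinf) \<le> ennreal ((C * Lp_norm 2 f)\<^sup>2)" (is "?I \<le> _") if f: "f \<in> Lp_Tinf 2" for f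
  proof -
    define a where "a n = fourier_coeff f (prime_exponents n)" for n
    define b where "b n = a n / of_real (real n powr u)" for n
    have bound: "(\<integral>\<^sup>+z. ennreal ((norm (\<Sum>i=m..<n. b i * zpow z (prime_exponents i)))\<^sup>2) \<partial>haar_Tinf)
        \<le> ennreal (\<Sum>i=m..<n. (norm (b i))\<^sup>2)" for m n
    proof -
      \<comment> \<open>\<open>prime_exponents\<close> is not injective at \<open>0\<close>, but \<open>b 0\<close> is a quotient by \<open>0\<close>, hence \<open>0\<close>.\<close>
      define A where "A = {m..<n} - {0}"
      have b0: "b 0 = 0" by (simp add: b_def)
      have inj: "inj_on prime_exponents A"
        by (rule inj_on_subset[OF inj_on_prime_exponents]) (auto simp: A_def)
      have inv: "nat_of_exponents (prime_exponents i) = i" if "i \<in> A" for i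
        using that by (intro nat_of_exponents_prime_exponents) (auto simp: A_def)
      have "(\<Sum>i=m..<n. b i * zpow z (prime_exponents i))
          = (\<Sum>\<alpha>\<in>prime_exponents ` A. b (nat_of_exponents \<alpha>) * zpow z \<alpha>)" for z
      proof -
        have "(\<Sum>i=m..<n. b i * zpow z (prime_exponents i)) = (\<Sum>i\<in>A. b i * zpow z (prime_exponents i))"
          unfolding A_def by (rule sum.mono_neutral_right) (auto simp: b0)
        then show ?thesis by (simp add: sum.reindex[OF inj] inv)
      qed
      then have "(\<integral>\<^sup>+z. ennreal ((norm (\<Sum>i=m..<n. b i * zpow z (prime_exponents i)))\<^sup>2) \<partial>haar_Tinf)
          = ennreal (\<Sum>\<alpha>\<in>prime_exponents ` A. (norm (b (nat_of_exponents \<alpha>)))\<^sup>2)"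
        by (simp add: nn_integral_trig_poly_norm2 A_def)
      also have "(\<Sum>\<alpha>\<in>prime_exponents ` A. (norm (b (nat_of_exponents \<alpha>)))\<^sup>2) = (\<Sum>i\<in>A. (norm (b i))\<^sup>2)"
        by (simp add: sum.reindex[OF inj] inv)
      also have "\<dots> \<le> (\<Sum>i=m..<n. (norm (b i))\<^sup>2)"
        by (rule sum_mono2) (auto simp: A_def)
      finally show ?thesis by (simp add: ennreal_leI)
    qed
    have "?I \<le> ennreal inv_squares_sum *
        suminf (\<lambda>j. ennreal ((real j + 1) ^ 4 * (\<Sum>i<2 ^ j. (norm (b (2 ^ j + i)))\<^sup>2)))"
      unfolding a_def[symmetric] b_def[symmetric]
      by (rule maximal_inequality_dyadic) (use bound in auto)
    also have "\<dots> \<le> ennreal inv_squares_sum * ennreal (B * (Lp_norm 2 f)\<^sup>2)"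
    \<comment> \<open>It suffices to bound the sum over the first k blocks. They cover exactly 1 <=
      n < 2^k, a finite set of distinct exponent sequences to which Bessel's inequality
      applies.\<close>
    proof (intro mult_left_mono suminf_le_const)
      fix k :: nat
      have block: "(real j + 1) ^ 4 * (\<Sum>i<2 ^ j. (norm (b (2 ^ j + i)))\<^sup>2)
          \<le> B * (\<Sum>i<2 ^ j. (norm (a (2 ^ j + i)))\<^sup>2)" for j :: nat
      proof -
        have "(norm (b n))\<^sup>2 \<le> (2 ^ j) powr (- (2 * u)) * (norm (a n))\<^sup>2" if n: "n \<ge> 2 ^ j" for n
        proof -
          have n0: "n > 0" using n by (rule less_le_trans[rotated]) simp
          have "real (2 ^ j) \<le> real n" using n by (rule of_nat_mono)
          then have "2 ^ j \<le> real n" by (simp only: of_nat_power of_nat_numeral)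
          then have le: "real n powr (- (2 * u)) \<le> (2 ^ j) powr (- (2 * u))"
            using u by (intro powr_mono2') auto
          have sq: "(real n powr u)\<^sup>2 = real n powr (2 * u)"
            by (simp add: power2_eq_square flip: powr_add)
          have "(norm (b n))\<^sup>2 = real n powr (- (2 * u)) * (norm (a n))\<^sup>2"
            by (simp add: b_def norm_divide power_divide sq powr_minus field_simps)
          also have "\<dots> \<le> (2 ^ j) powr (- (2 * u)) * (norm (a n))\<^sup>2"
            using le by (intro mult_right_mono) auto
          finally show ?thesis .
        qed
        then have "(\<Sum>i<2 ^ j. (norm (b (2 ^ j + i)))\<^sup>2)
            \<le> (2 ^ j) powr (- (2 * u)) * (\<Sum>i<2 ^ j. (norm (a (2 ^ j + i)))\<^sup>2)"
          unfolding sum_distrib_left by (intro sum_mono) simp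
        then have "(real j + 1) ^ 4 * (\<Sum>i<2 ^ j. (norm (b (2 ^ j + i)))\<^sup>2)
            \<le> (real j + 1) ^ 4 * ((2 ^ j) powr (- (2 * u)) * (\<Sum>i<2 ^ j. (norm (a (2 ^ j + i)))\<^sup>2))"
          by (intro mult_left_mono) auto
        also have "\<dots> \<le> B * (\<Sum>i<2 ^ j. (norm (a (2 ^ j + i)))\<^sup>2)"
          unfolding mult.assoc[symmetric] by (intro mult_right_mono B sum_nonneg) auto
        finally show ?thesis .
      qed
      have "(\<Sum>j<k. ennreal ((real j + 1) ^ 4 * (\<Sum>i<2 ^ j. (norm (b (2 ^ j + i)))\<^sup>2)))
          = ennreal (\<Sum>j<k. (real j + 1) ^ 4 * (\<Sum>i<2 ^ j. (norm (b (2 ^ j + i)))\<^sup>2))"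
        by (rule sum_ennreal) (auto intro!: mult_nonneg_nonneg sum_nonneg)
      also have "\<dots> \<le> ennreal (B * (Lp_norm 2 f)\<^sup>2)"
      proof (rule ennreal_leI)
        have "(\<Sum>j<k. (real j + 1) ^ 4 * (\<Sum>i<2 ^ j. (norm (b (2 ^ j + i)))\<^sup>2))
            \<le> B * (\<Sum>j<k. \<Sum>i<2 ^ j. (norm (a (2 ^ j + i)))\<^sup>2)"
          unfolding sum_distrib_left[of B _ "{..<k}"] by (intro sum_mono block)
        also have "(\<Sum>j<k. \<Sum>i<2 ^ j. (norm (a (2 ^ j + i)))\<^sup>2) = (\<Sum>n\<in>{1..<2 ^ k}. (norm (a n))\<^sup>2)"
          by (rule sum_over_dyadic_blocks[symmetric])
        also have "\<dots> = (\<Sum>\<alpha>\<in>prime_exponents ` {1..<2 ^ k}. (norm (fourier_coeff f \<alpha>))\<^sup>2)"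
          unfolding a_def
          by (subst sum.reindex) (auto intro: inj_on_subset[OF inj_on_prime_exponents])
        also have "\<dots> \<le> (Lp_norm 2 f)\<^sup>2" by (rule bessel_inequality[OF f]) simp
        finally show "(\<Sum>j<k. (real j + 1) ^ 4 * (\<Sum>i<2 ^ j. (norm (b (2 ^ j + i)))\<^sup>2))
            \<le> B * (Lp_norm 2 f)\<^sup>2" using B(1) by simp
      qed
      finally show "(\<Sum>j<k. ennreal ((real j + 1) ^ 4 * (\<Sum>i<2 ^ j. (norm (b (2 ^ j + i)))\<^sup>2)))
          \<le> ennreal (B * (Lp_norm 2 f)\<^sup>2)" .
    qed auto
    also have "\<dots> = ennreal (K * (Lp_norm 2 f)\<^sup>2)"
      by (simp add: K_def inv_squares_sum_nonneg mult.assoc flip: ennreal_mult')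
    also have "\<dots> \<le> ennreal ((C * Lp_norm 2 f)\<^sup>2)"
      unfolding power_mult_distrib by (intro ennreal_leI mult_right_mono C) simp
    finally show ?thesis .
  qed
  then show ?thesis using C(1) by blast
qed

section \<open>Transfer to the character group and conclusion\<close>

lemma Xi_iso_measurable: "Xi_iso \<in> vimage_algebra Xi Xi_iso haar_Tinf \<rightarrow>\<^sub>M haar_Tinf"
  by (rule measurable_vimage_algebra1) (use bij_betwE[OF bij_Xi_iso] in auto)

lemma Xi_iso_the_inv_into:
  assumes "z \<in> space haar_Tinf"
  shows "the_inv_into Xi Xi_iso z \<in> Xi" "Xi_iso (the_inv_into Xi Xi_iso z) = z"
proof -
  have inj: "inj_on Xi_iso Xi" and z: "z \<in> Xi_iso ` Xi"
    using bij_Xi_iso assms by (auto simp: bij_betw_def)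
  show "the_inv_into Xi Xi_iso z \<in> Xi" by (rule the_inv_into_into[OF inj z subset_refl])
  show "Xi_iso (the_inv_into Xi Xi_iso z) = z" by (rule f_the_inv_into_f[OF inj z])
qed

lemma the_inv_into_Xi_iso_measurable:
  "the_inv_into Xi Xi_iso \<in> haar_Tinf \<rightarrow>\<^sub>M vimage_algebra Xi Xi_iso haar_Tinf"
proof (rule measurable_vimage_algebra2)
  show "(\<lambda>z. Xi_iso (the_inv_into Xi Xi_iso z)) \<in> haar_Tinf \<rightarrow>\<^sub>M haar_Tinf"
    by (subst measurable_cong[where g = "\<lambda>z. z"]) (auto simp: Xi_iso_the_inv_into)
qed (use Xi_iso_the_inv_into in auto)

text \<open>The sigma-algebra on \<open>Xi\<close> is pulled back from the polytorus, where
  evaluation at n becomes a monomial.\<close>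

lemma evaluation_measurable_Xi:
  assumes "n \<ge> 1"
  shows "(\<lambda>\<xi>. \<xi> n) \<in> borel_measurable (vimage_algebra Xi Xi_iso haar_Tinf)"
proof (subst measurable_cong)
  show "\<xi> n = zpow (Xi_iso \<xi>) (prime_exponents n)" if "\<xi> \<in> space (vimage_algebra Xi Xi_iso haar_Tinf)" for \<xi>
    using that assms by (simp add: Xi_eq_zpow)
  show "(\<lambda>\<xi>. zpow (Xi_iso \<xi>) (prime_exponents n)) \<in> borel_measurable (vimage_algebra Xi Xi_iso haar_Tinf)"
    by (rule measurable_compose[OF Xi_iso_measurable zpow_measurable])
qed

text \<open>Change of variables along the inverse of \<open>Xi_iso\<close>. The integrand is
  measurable because its supremum runs over a countable set.\<close>

lemma nn_integral_haar_Xi: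
  "(\<integral>\<^sup>+\<xi>. (SUP x\<in>{1::nat..}. ennreal (norm (\<Sum>n=1..x. c n * \<xi> n)))\<^sup>2 \<partial>haar_Xi)
    = (\<integral>\<^sup>+z. (SUP x\<in>{1::nat..}. ennreal (norm (\<Sum>n=1..x. c n * zpow z (prime_exponents n))))\<^sup>2 \<partial>haar_Tinf)"
proof -
  let ?V = "vimage_algebra Xi Xi_iso haar_Tinf"
  let ?g = "\<lambda>\<xi>. (SUP x\<in>{1::nat..}. ennreal (norm (\<Sum>n=1..x. c n * \<xi> n)))\<^sup>2"
  have "(\<lambda>\<xi>. \<Sum>n=1..x. c n * \<xi> n) \<in> borel_measurable ?V" for x
    by (intro borel_measurable_sum borel_measurable_times borel_measurable_const evaluation_measurable_Xi) auto
  then have "?g \<in> borel_measurable ?V" by measurable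
  then have "(\<integral>\<^sup>+\<xi>. ?g \<xi> \<partial>haar_Xi) = (\<integral>\<^sup>+z. ?g (the_inv_into Xi Xi_iso z) \<partial>haar_Tinf)"
    unfolding haar_Xi_def by (intro nn_integral_distr the_inv_into_Xi_iso_measurable) simp
  also have "\<dots> = (\<integral>\<^sup>+z. (SUP x\<in>{1::nat..}. ennreal (norm (\<Sum>n=1..x. c n * zpow z (prime_exponents n))))\<^sup>2 \<partial>haar_Tinf)"
  proof (rule nn_integral_cong)
    fix z assume z: "z \<in> space haar_Tinf"
    have "the_inv_into Xi Xi_iso z n = zpow z (prime_exponents n)" if "n \<ge> 1" for n
      using Xi_eq_zpow[OF Xi_iso_the_inv_into(1)[OF z] that] by (simp add: Xi_iso_the_inv_into(2)[OF z])
    then show "?g (the_inv_into Xi Xi_iso z)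
        = (SUP x\<in>{1::nat..}. ennreal (norm (\<Sum>n=1..x. c n * zpow z (prime_exponents n))))\<^sup>2"
      by (intro arg_cong[where f = "\<lambda>t. t\<^sup>2"] SUP_cong refl arg_cong[where f = ennreal]
          arg_cong[where f = norm] sum.cong) auto
  qed
  finally show ?thesis .
qed

text \<open>As \<open>enn2real\<close> sends infinity to 0, the real inequality alone would be void
  for a divergent integral; finiteness is therefore delivered with it.\<close>

lemma sqrt_enn2real_le:
  assumes "I \<le> ennreal (r\<^sup>2)" "r \<ge> 0"
  shows "I < \<infinity> \<and> sqrt (enn2real I) \<le> r"
proof
  show "I < \<infinity>" using assms(1) by (rule le_less_trans) simp
  have "enn2real I \<le> r\<^sup>2" using assms(1) by (rule enn2real_leI[rotated]) simp
  then show "sqrt (enn2real I) \<le> r" using assms(2) by (intro real_le_lsqrt) auto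
qed

lemma Lp_norm_nonneg: "Lp_norm p f \<ge> 0"
  by (simp add: Lp_norm_def)

theorem theorem3p1:
  fixes u :: real
  assumes "u > 0"
  shows "\<exists>C>0.
    (\<forall>a \<in> dirichlet_Hp 2.
       (let I = (\<integral>\<^sup>+\<xi>. (SUP x\<in>{1::nat..}.
                   ennreal (norm (\<Sum>n=1..x. a n / of_real (real n powr u) * \<xi> n)))\<^sup>2 \<partial>haar_Xi)
        in I < \<infinity> \<and> sqrt (enn2real I) \<le> C * dirichlet_norm 2 a))
    \<and>
    (\<forall>f \<in> Hp_Tinf 2.
       (let I = (\<integral>\<^sup>+z. (SUP x\<in>{0::real<..}.
                   ennreal (norm (\<Sum>\<alpha> | \<alpha> \<in> nonneg_idx \<and> ppow \<alpha> < x.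
                     fourier_coeff f \<alpha> / of_real (ppow \<alpha> powr u) * zpow z \<alpha>)))\<^sup>2 \<partial>haar_Tinf)
        in I < \<infinity> \<and> sqrt (enn2real I) \<le> C * Lp_norm 2 f))"
proof -
  let ?S = "\<lambda>f z N. \<Sum>n=1..N.
      fourier_coeff f (prime_exponents n) / of_real (real n powr u) * zpow z (prime_exponents n)"
  obtain C where C: "C > 0" and main: "\<And>f. f \<in> Lp_Tinf 2 \<Longrightarrow>
      (\<integral>\<^sup>+z. (SUP N\<in>{1..}. ennreal (norm (?S f z N)))\<^sup>2 \<partial>haar_Tinf) \<le> ennreal ((C * Lp_norm 2 f)\<^sup>2)"
    using maximal_inequality_Tinf[OF assms] by blast
  show ?thesis
  proof (intro exI[of _ C] conjI ballI C)
    fix a assume "a \<in> dirichlet_Hp 2"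
    \<comment> \<open>This is the very lift chosen inside \<open>dirichlet_norm\<close>, so the norm
      of a unfolds to \<open>Lp_norm 2 f\<close>.\<close>
    define f where "f = (SOME f. is_bohr_lift 2 a f)"
    have lift: "is_bohr_lift 2 a f"
      using \<open>a \<in> dirichlet_Hp 2\<close> unfolding f_def dirichlet_Hp_def by (auto intro: someI[of "is_bohr_lift 2 a"])
    then have f: "f \<in> Lp_Tinf 2" by (simp add: is_bohr_lift_def Hp_Tinf_def)
    have "a n = fourier_coeff f (prime_exponents n)" if "n \<ge> 1" for n
      using lift that unfolding is_bohr_lift_def
      by (simp add: ppow_prime_exponents prime_exponents_nonneg)
    then have "(\<Sum>n=1..x. a n / of_real (real n powr u) * zpow z (prime_exponents n)) = ?S f z x" for z x
      by (intro sum.cong) auto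
    then show "let I = (\<integral>\<^sup>+\<xi>. (SUP x\<in>{1::nat..}.
          ennreal (norm (\<Sum>n=1..x. a n / of_real (real n powr u) * \<xi> n)))\<^sup>2 \<partial>haar_Xi)
        in I < \<infinity> \<and> sqrt (enn2real I) \<le> C * dirichlet_norm 2 a"
      unfolding Let_def nn_integral_haar_Xi dirichlet_norm_def f_def[symmetric]
      using main[OF f] C by (intro sqrt_enn2real_le) (auto simp: Lp_norm_nonneg)
  next
    fix f assume "f \<in> Hp_Tinf 2"
    then have f: "f \<in> Lp_Tinf 2" by (simp add: Hp_Tinf_def)
    have "(\<integral>\<^sup>+z. (SUP x\<in>{0::real<..}. ennreal (norm (\<Sum>\<alpha> | \<alpha> \<in> nonneg_idx \<and> ppow \<alpha> < x.
            fourier_coeff f \<alpha> / of_real (ppow \<alpha> powr u) * zpow z \<alpha>)))\<^sup>2 \<partial>haar_Tinf)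
        \<le> (\<integral>\<^sup>+z. (SUP N\<in>{1..}. ennreal (norm (?S f z N)))\<^sup>2 \<partial>haar_Tinf)"
    \<comment> \<open>The supremum over real x is uncountable, but monotonicity of the nonnegative
      integral asks for no measurability; each x is compared with one integer length N.\<close>
    proof (intro nn_integral_mono power_mono SUP_least)
      fix z and x :: real assume "x \<in> {0<..}"
      then have x: "x > 0" by simp
      define N where "N = nat (\<lceil>x\<rceil> - 1)"
      have eq: "(\<Sum>\<alpha> | \<alpha> \<in> nonneg_idx \<and> ppow \<alpha> < x.
          fourier_coeff f \<alpha> / of_real (ppow \<alpha> powr u) * zpow z \<alpha>) = ?S f z N"
        unfolding sum_ppow_less[OF x] N_def by (intro sum.cong) (auto simp: ppow_prime_exponents)
      show "ennreal (norm (\<Sum>\<alpha> | \<alpha> \<in> nonneg_idx \<and> ppow \<alpha> < x.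
          fourier_coeff f \<alpha> / of_real (ppow \<alpha> powr u) * zpow z \<alpha>))
          \<le> (SUP N\<in>{1..}. ennreal (norm (?S f z N)))"
      \<comment> \<open>N = 0 occurs for x at most 1: the sum is then empty, and 0 lies outside the
        range of the supremum over N.\<close>
      proof (cases "N = 0")
        case True
        then show ?thesis unfolding eq by simp
      next
        case False
        then show ?thesis unfolding eq by (intro SUP_upper) auto
      qed
    qed simp
    also note main[OF f]
    finally show "let I = (\<integral>\<^sup>+z. (SUP x\<in>{0::real<..}. ennreal (norm (\<Sum>\<alpha> | \<alpha> \<in> nonneg_idx \<and> ppow \<alpha> < x.
            fourier_coeff f \<alpha> / of_real (ppow \<alpha> powr u) * zpow z \<alpha>)))\<^sup>2 \<partial>haar_Tinf)
        in I < \<infinity> \<and> sqrt (enn2real I) \<le> C * Lp_norm 2 f"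
      unfolding Let_def using C by (intro sqrt_enn2real_le) (auto simp: Lp_norm_nonneg)
  qed
qed

end
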